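(* Let $(H_N)_{N\in\mathbb{N}}$ be the Hamiltonians of a Gaussian spin glass, with partition functions $Z_N(\beta)$ and Gibbs measures $\mathcal{G}_{\beta,N}$. If $\lim_{N\to\infty}\frac1N E\log Z_N(\beta)$ exists and is differentiable (as a function of the inverse temperature) at $\beta>0$, then the sequence of Gibbs measures $(\mathcal{G}_{\beta,N})_N$ is stochastically stable: for any $\lambda>0$, any $s\in\mathbb{N}$ and any continuous function $F$ on $s$ replicas, $$\lim_{N\to\infty}\left|E E_l\left[\frac{\mathcal{G}_{\beta,N}^{\otimes s}\big(F(\vec\sigma)e^{\lambda l(\sigma^1)}\cdots e^{\lambda l(\sigma^s)}\big)}{\mathcal{G}_{\beta,N}^{\otimes s}\big(e^{\lambda l(\sigma^1)}\cdots e^{\lambda l(\sigma^s)}\big)}\right]-E\,\mathcal{G}_{\beta,N}^{\otimes s}\big(F(\vec\sigma)\big)\right|=0 .$$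
   Context: For each $N\in\mathbb{N}$, the Hamiltonian $H_N=(H_N(\sigma),\sigma\in\{-1,+1\}^N)$ of a Gaussian spin glass is a centered Gaussian vector with covariance $E[H_N(\sigma)H_N(\sigma')]=N r(\sigma,\sigma')$, where $r=r_N$ is a positive definite (in the kernel sense, i.e. positive semidefinite) symmetric form on $\{-1,+1\}^N$ with $r(\sigma,\sigma)=1$ for all $\sigma$; $E$ is expectation over $H_N$. The partition function is $Z_N(\beta)=\sum_\sigma e^{\beta H_N(\sigma)}$ and the Gibbs measure is $\mathcal{G}_{\beta,N}(\sigma)=e^{\beta H_N(\sigma)}/Z_N(\beta)$. For a function $g$ of $s$ configurations, $\mathcal{G}_{\beta,N}^{\otimes s}(g)$ is its expectation under the $s$-fold product measure, with $\vec\sigma=(\sigma^1,\dots,\sigma^s)$. The field $(l(\sigma),\sigma\in\{-1,+1\}^N)$ is a centered Gaussian vector independent of $H_N$, with expectation $E_l$ and covariance $E_l[l(\sigma)l(\sigma')]=r(\sigma,\sigma')$. A continuous function $F$ on $s$ replicas is a real continuous function of the variables $(x_{kl})_{1\le k<l\le s}\in[-1,1]^{s(s-1)/2}$ (not depending on $N$), and $F(\vec\sigma)$ means $F(r(\sigma^k,\sigma^l);1\le k<l\le s)$. *)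

theory Defs
  imports "HOL-Probability.Probability"
begin

type_synonym config = "nat \<Rightarrow> int"

definition configs :: "nat \<Rightarrow> config set" where
  "configs N = ({1..N} \<rightarrow>\<^sub>E {-1, 1})"

(* Constants count as Gaussian (variance 0), since covariances may be degenerate. *)
definition gaussian_rv :: "'a measure \<Rightarrow> ('a \<Rightarrow> real) \<Rightarrow> bool" where
  "gaussian_rv M X \<longleftrightarrow>
     (\<exists>\<mu> \<sigma>. \<sigma> > 0 \<and> distributed M lborel X (normal_density \<mu> \<sigma>)) \<or>
     (X \<in> borel_measurable M \<and> (\<exists>\<mu>. AE \<omega> in M. X \<omega> = \<mu>))"

definition centered_gaussian_vector ::
    "'a measure \<Rightarrow> 'i set \<Rightarrow> ('i \<Rightarrow> 'a \<Rightarrow> real) \<Rightarrow> ('i \<Rightarrow> 'i \<Rightarrow> real) \<Rightarrow> bool" where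
  "centered_gaussian_vector M I X C \<longleftrightarrow>
     (\<forall>i\<in>I. X i \<in> borel_measurable M) \<and>
     (\<forall>a :: 'i \<Rightarrow> real. gaussian_rv M (\<lambda>\<omega>. \<Sum>i\<in>I. a i * X i \<omega>)) \<and>
     (\<forall>i\<in>I. (\<integral>\<omega>. X i \<omega> \<partial>M) = 0) \<and>
     (\<forall>i\<in>I. \<forall>j\<in>I. (\<integral>\<omega>. X i \<omega> * X j \<omega> \<partial>M) = C i j)"

definition overlap_form :: "nat \<Rightarrow> (config \<Rightarrow> config \<Rightarrow> real) \<Rightarrow> bool" where
  "overlap_form N r \<longleftrightarrow>
     (\<forall>\<sigma>\<in>configs N. \<forall>\<sigma>'\<in>configs N. r \<sigma> \<sigma>' = r \<sigma>' \<sigma>) \<and>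
     (\<forall>c :: config \<Rightarrow> real. 0 \<le> (\<Sum>\<sigma>\<in>configs N. \<Sum>\<sigma>'\<in>configs N. c \<sigma> * c \<sigma>' * r \<sigma> \<sigma>')) \<and>
     (\<forall>\<sigma>\<in>configs N. r \<sigma> \<sigma> = 1)"

definition gaussian_spin_glass ::
    "'a measure \<Rightarrow> nat \<Rightarrow> (config \<Rightarrow> config \<Rightarrow> real) \<Rightarrow> (config \<Rightarrow> 'a \<Rightarrow> real) \<Rightarrow> bool" where
  "gaussian_spin_glass M N r H \<longleftrightarrow>
     prob_space M \<and> overlap_form N r \<and>
     centered_gaussian_vector M (configs N) H (\<lambda>\<sigma> \<sigma>'. real N * r \<sigma> \<sigma>')"

(* X and Y live on the same probability space, so that for independent X and Y the iterated
   expectation (over Y, then over X) is the expectation with respect to M. *)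
definition indep_fields ::
    "'a measure \<Rightarrow> 'i set \<Rightarrow> ('i \<Rightarrow> 'a \<Rightarrow> real) \<Rightarrow> ('i \<Rightarrow> 'a \<Rightarrow> real) \<Rightarrow> bool" where
  "indep_fields M I X Y \<longleftrightarrow>
     prob_space.indep_var M
       (\<Pi>\<^sub>M i\<in>I. borel) (\<lambda>\<omega>. \<lambda>i\<in>I. X i \<omega>)
       (\<Pi>\<^sub>M i\<in>I. borel) (\<lambda>\<omega>. \<lambda>i\<in>I. Y i \<omega>)"

(* In the following three definitions h is one realization of the Hamiltonian. *)
definition partition_fun :: "nat \<Rightarrow> (config \<Rightarrow> real) \<Rightarrow> real \<Rightarrow> real" where
  "partition_fun N h \<beta> = (\<Sum>\<sigma>\<in>configs N. exp (\<beta> * h \<sigma>))"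

definition gibbs :: "nat \<Rightarrow> (config \<Rightarrow> real) \<Rightarrow> real \<Rightarrow> config \<Rightarrow> real" where
  "gibbs N h \<beta> \<sigma> = exp (\<beta> * h \<sigma>) / partition_fun N h \<beta>"

(* Expectation of g under the s-fold product of the Gibbs measure; the replicas
   \<sigma> 1, ..., \<sigma> s are the components of \<sigma>. *)
definition gibbs_expectation ::
    "nat \<Rightarrow> (config \<Rightarrow> real) \<Rightarrow> real \<Rightarrow> nat \<Rightarrow> ((nat \<Rightarrow> config) \<Rightarrow> real) \<Rightarrow> real" where
  "gibbs_expectation N h \<beta> s g =
     (\<Sum>\<sigma>\<in>{1..s} \<rightarrow>\<^sub>E configs N. g \<sigma> * (\<Prod>k\<in>{1..s}. gibbs N h \<beta> (\<sigma> k)))"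

definition replica_pairs :: "nat \<Rightarrow> (nat \<times> nat) set" where
  "replica_pairs s = {(k, l). 1 \<le> k \<and> k < l \<and> l \<le> s}"

definition continuous_on_replicas :: "nat \<Rightarrow> ((nat \<times> nat \<Rightarrow> real) \<Rightarrow> real) \<Rightarrow> bool" where
  "continuous_on_replicas s F \<longleftrightarrow>
     continuous_map (product_topology (\<lambda>_. top_of_set {-1..1}) (replica_pairs s)) euclideanreal F"

definition at_replicas ::
    "nat \<Rightarrow> (config \<Rightarrow> config \<Rightarrow> real) \<Rightarrow> ((nat \<times> nat \<Rightarrow> real) \<Rightarrow> real) \<Rightarrow> (nat \<Rightarrow> config) \<Rightarrow> real" where
  "at_replicas s r F \<sigma> = F (restrict (\<lambda>(k, l). r (\<sigma> k) (\<sigma> l)) (replica_pairs s))"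

definition free_energy ::
    "'a measure \<Rightarrow> nat \<Rightarrow> (config \<Rightarrow> 'a \<Rightarrow> real) \<Rightarrow> real \<Rightarrow> real" where
  "free_energy M N H \<beta> = (\<integral>\<omega>. ln (partition_fun N (\<lambda>\<sigma>. H \<sigma> \<omega>) \<beta>) \<partial>M) / real N"

end

theory Submission
  imports Defs
begin

text \<open>The field \<open>\<beta> H + \<lambda> l\<close> has the same law as \<open>\<beta>' H\<close> with \<open>\<beta>' = sqrt (\<beta>\<^sup>2 + \<lambda>\<^sup>2 / N)\<close>, so the
  tilt by \<open>l\<close> only shifts the inverse temperature by at most \<open>\<lambda>\<^sup>2 / (2 \<beta> N)\<close>. For fixed disorder, the
  derivative in \<open>\<beta>\<close> of a replica expectation of a function bounded by \<open>B\<close> is at most \<open>B s\<close> times the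
  Gibbs mean of \<open>\<bar>H - \<langle>H\<rangle>\<bar>\<close>, hence at most \<open>(B s / 2) (V / t + t)\<close>, where \<open>V\<close> is the Gibbs variance
  of \<open>H\<close>, i.e. the second derivative of \<open>ln Z\<close>. Integrating over \<open>[\<beta>, \<beta>']\<close> with \<open>t = \<eta> N\<close> leaves \<open>1 / \<eta>\<close>
  times an increment of the derivative of the free energy, which convexity bounds by difference
  quotients; these cancel in the limit because the limiting free energy is differentiable at \<open>\<beta>\<close>.
  The remaining term is of order \<open>\<eta>\<close>.\<close>

section \<open>Characteristic functions and laws of random vectors\<close>

lemma iexp_add: "iexp (u + v) = iexp u * iexp v"
  by (simp add: exp_add distrib_left)

text \<open>Euler's formula for the cosine leaves only pure exponentials, all with the same real
  weight \<open>p\<close>, so identities known for weighted characteristic functions apply term by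
  term.\<close>

lemma cos_weight_mult_iexp:
  "complex_of_real (p * (1 + cos (u + \<theta>))) * iexp v
    = p * iexp v + iexp \<theta> / 2 * (p * iexp (u + v)) + iexp (-\<theta>) / 2 * (p * iexp (- u + v))"
proof -
  have "complex_of_real (cos (u + \<theta>)) = (iexp (u + \<theta>) + iexp (- u + - \<theta>)) / 2"
    by (simp add: complex_eq_iff Re_exp Im_exp cos_add sin_add cos_diff sin_diff)
  then have c: "complex_of_real (cos (u + \<theta>)) = (iexp u * iexp \<theta> + iexp (-u) * iexp (-\<theta>)) / 2"
    unfolding iexp_add .
  have *: "p * (1 + (b * a + b' * a') / 2) * e = p * e + a / 2 * (p * (b * e)) + a' / 2 * (p * (b' * e))"
    for p a b a' b' e :: complex
    by (simp add: field_simps)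
  show ?thesis
    unfolding iexp_add unfolding of_real_mult of_real_add c of_real_1 by (rule *)
qed

text \<open>The sine is a cosine with phase -pi/2, so integrals against cosines of arbitrary phase
  determine the complex exponential and need no separate sine argument.\<close>

lemma mult_iexp_eq_cos:
  "complex_of_real q * iexp u = of_real (q * cos (u + 0)) + \<i> * of_real (q * cos (u + - pi / 2))"
  by (simp add: complex_eq_iff Re_exp Im_exp cos_diff)
context prob_space begin

text \<open>Normalised to mass 1, a weight is a probability density; the laws of \<open>X\<close>
  and \<open>Y\<close> under these densities have equal characteristic functions, so Levy's
  uniqueness theorem identifies them.\<close>

lemma weighted_law_eqI:
  fixes X Y w v :: "'a \<Rightarrow> real"
  assumes [measurable]: "random_variable borel X" "random_variable borel Y"
    "random_variable borel w" "random_variable borel v"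
    and w: "\<And>x. 0 \<le> w x" "\<And>x. w x \<le> B" and v: "\<And>x. 0 \<le> v x" "\<And>x. v x \<le> B"
    and eq: "\<And>t. (CLINT x|M. w x * iexp (t * X x)) = (CLINT x|M. v x * iexp (t * Y x))"
    and A [measurable]: "A \<in> sets borel"
  shows "expectation (\<lambda>x. w x * indicator A (X x)) = expectation (\<lambda>x. v x * indicator A (Y x))"
proof -
  have int: "integrable M w" "integrable M v"
    using w v by (auto intro!: integrable_const_bound[where B = B])
  define c where "c = expectation w"
  \<comment> \<open>At frequency 0 the hypothesis compares the total masses.\<close>
  have c_v: "c = expectation v"
    using eq[of 0] by (simp add: c_def)
  have c0: "c \<ge> 0" unfolding c_def using w by simp
  show ?thesis
  proof (cases "c = 0")
    \<comment> \<open>Mass 0 cannot be normalised, but then both weights vanish almost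
      everywhere.\<close>
    case True
    then have "AE x in M. w x = 0" "AE x in M. v x = 0"
      using int w v integral_nonneg_eq_0_iff_AE[of M w] integral_nonneg_eq_0_iff_AE[of M v]
      by (auto simp: c_def[symmetric] c_v[symmetric])
    then have "expectation (\<lambda>x. w x * indicator A (X x)) = expectation (\<lambda>x. 0)"
      "expectation (\<lambda>x. v x * indicator A (Y x)) = expectation (\<lambda>x. 0)"
      by (intro integral_cong_AE; force)+
    then show ?thesis by simp
  next
    case False
    with c0 have c: "c > 0" by simp
    define L where "L u Z = distr (density M (\<lambda>x. ennreal (u x / c))) borel Z"
      for u Z :: "'a \<Rightarrow> real"
    have L: "real_distribution (L u Z)" "char (L u Z) t = (CLINT x|M. u x * iexp (t * Z x)) / c"
      "measure (L u Z) A = expectation (\<lambda>x. u x * indicator A (Z x)) / c"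
      if [measurable]: "random_variable borel u" "random_variable borel Z"
        and u: "\<And>x. 0 \<le> u x" "integrable M u" "expectation u = c" for u Z t
    proof -
      have "emeasure (density M (\<lambda>x. ennreal (u x / c))) (space M) = (\<integral>\<^sup>+x. ennreal (u x / c) \<partial>M)"
        by (subst emeasure_density) (auto intro!: nn_integral_cong)
      also have "\<dots> = ennreal (expectation (\<lambda>x. u x / c))"
        using u c by (intro nn_integral_eq_integral) auto
      also have "\<dots> = 1" using u c by simp
      finally interpret D: prob_space "density M (\<lambda>x. ennreal (u x / c))"
        by (intro prob_spaceI) simp
      show "real_distribution (L u Z)"
        unfolding L_def by (intro D.real_distribution_distr) simp
      have "char (L u Z) t = (CLINT x|M. (u x / c) *\<^sub>R iexp (t * Z x))"
        unfolding L_def char_def using u c by (simp add: integral_distr integral_density)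
      also have "\<dots> = (CLINT x|M. (u x * iexp (t * Z x)) / c)"
        by (intro Bochner_Integration.integral_cong) (auto simp: scaleR_conv_of_real)
      finally show "char (L u Z) t = (CLINT x|M. u x * iexp (t * Z x)) / c" by simp
      interpret R: real_distribution "L u Z" by fact
      have "measure (L u Z) A = (\<integral>x. indicator A x \<partial>L u Z)" by simp
      also have "\<dots> = expectation (\<lambda>x. (u x / c) * indicator A (Z x))"
        unfolding L_def using u c by (subst integral_distr, simp, simp, subst integral_density) auto
      finally show "measure (L u Z) A = expectation (\<lambda>x. u x * indicator A (Z x)) / c" by simp
    qed
    have "L w X = L v Y"
      using w v int c_v c_def eq by (intro Levy_uniqueness L ext) (auto simp: L)
    then have "measure (L w X) A = measure (L v Y) A" by simp
    then show ?thesis using L(3)[of w X] L(3)[of v Y] w v int c_v c_def c by simp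
  qed
qed

text \<open>The coordinates are treated one at a time: multiplying a nonnegative weight into the law of
  one coordinate reduces the step to the one-dimensional uniqueness theorem. The factor
  \<open>1 + cos\<close> makes the oscillating part of the characteristic function such a weight.\<close>

lemma distr_PiM_eqI_char:
  fixes X Y :: "'i \<Rightarrow> 'a \<Rightarrow> real"
  assumes fin: "finite I"
    and X: "\<And>i. i \<in> I \<Longrightarrow> random_variable borel (X i)"
    and Y: "\<And>i. i \<in> I \<Longrightarrow> random_variable borel (Y i)"
    and eq: "\<And>a. (CLINT x|M. iexp (\<Sum>i\<in>I. a i * X i x)) = (CLINT x|M. iexp (\<Sum>i\<in>I. a i * Y i x))"
  shows "distr M (\<Pi>\<^sub>M i\<in>I. borel) (\<lambda>x. \<lambda>i\<in>I. X i x) = distr M (\<Pi>\<^sub>M i\<in>I. borel) (\<lambda>x. \<lambda>i\<in>I. Y i x)"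
proof -
  define P :: "('i \<Rightarrow> 'a \<Rightarrow> real) \<Rightarrow> 'i set \<Rightarrow> ('i \<Rightarrow> real set) \<Rightarrow> 'a \<Rightarrow> real"
    where "P Z J A x = (\<Prod>i\<in>J. indicator (A i) (Z i x))" for Z J A x
  define S :: "('i \<Rightarrow> 'a \<Rightarrow> real) \<Rightarrow> ('i \<Rightarrow> real) \<Rightarrow> 'a \<Rightarrow> real"
    where "S Z a x = (\<Sum>i\<in>I. a i * Z i x)" for Z a x
  have P01: "0 \<le> P Z J A x" "P Z J A x \<le> 1" for Z J A x
    unfolding P_def by (auto intro!: prod_nonneg prod_le_1 simp: indicator_def)
  have P_meas: "P Z J A \<in> borel_measurable M"
    if "J \<subseteq> I" "\<And>i. A i \<in> sets borel" "\<And>i. i \<in> I \<Longrightarrow> random_variable borel (Z i)" for Z J A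
  proof -
    have "(\<lambda>x. indicator (A i) (Z i x) :: real) \<in> borel_measurable M" if "i \<in> J" for i
      using measurable_compose[of "Z i" M borel "indicator (A i)" borel] that \<open>J \<subseteq> I\<close>
        \<open>\<And>i. A i \<in> sets borel\<close> \<open>\<And>i. i \<in> I \<Longrightarrow> random_variable borel (Z i)\<close> by auto
    then show ?thesis unfolding P_def by measurable
  qed
  have S_meas: "S Z a \<in> borel_measurable M"
    if "\<And>i. i \<in> I \<Longrightarrow> random_variable borel (Z i)" for Z a
    unfolding S_def using that by measurable
  have bint: "integrable M f" if "f \<in> borel_measurable M" "\<And>x. norm (f x) \<le> 2" for f :: "'a \<Rightarrow> complex"
    using that by (auto intro: integrable_const_bound[where B = 2])
  have rbint: "integrable M f" if "f \<in> borel_measurable M" "\<And>x. norm (f x) \<le> 2" for f :: "'a \<Rightarrow> real"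
    using that by (auto intro: integrable_const_bound[where B = 2])
  have nrm: "norm (complex_of_real p * exp (\<i> * complex_of_real s)) \<le> 2" if "0 \<le> p" "p \<le> 1" for p s
    using that by (simp add: norm_mult)
  \<comment> \<open>Induction over the set \<open>J\<close> of coordinates already tested by
    indicators; the exponential keeps all coordinates and arbitrary \<open>a\<close>.
    \<open>J = {}\<close> is the hypothesis, and \<open>J = I\<close> with \<open>a = 0\<close> is
    equality on rectangles.\<close>
  have main: "(CLINT x|M. P X J A x * iexp (S X a x)) = (CLINT x|M. P Y J A x * iexp (S Y a x))"
    if "J \<subseteq> I" "\<And>i. A i \<in> sets borel" for J A a
  proof -
    have "finite J" using that fin finite_subset by auto
    then show ?thesis using that(1)
    proof (induction J arbitrary: a)
      case empty
      then show ?case using eq[of a] by (simp add: P_def S_def)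
    next
      case (insert j J)
      note PX = P_meas[of J A X, OF _ that(2) X] P_meas[of J A Y, OF _ that(2) Y]
      have [measurable]: "P X J A \<in> borel_measurable M" "P Y J A \<in> borel_measurable M"
        "random_variable borel (X j)" "random_variable borel (Y j)"
        "\<And>a. S X a \<in> borel_measurable M" "\<And>a. S Y a \<in> borel_measurable M" "\<And>i. A i \<in> sets borel"
        using insert PX X Y S_meas that by auto
      have IH: "(CLINT x|M. P X J A x * iexp (S X a x)) = (CLINT x|M. P Y J A x * iexp (S Y a x))" for a
        using insert by auto
      \<comment> \<open>The weight lies between 0 and 2, so the uniqueness lemma for weighted laws
        brings in the indicator for the new coordinate \<open>j\<close>.\<close>
      have step: "expectation (\<lambda>x. P X J A x * (1 + cos (S X a x + \<theta>)) * indicator (A j) (X j x))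
          = expectation (\<lambda>x. P Y J A x * (1 + cos (S Y a x + \<theta>)) * indicator (A j) (Y j x))" for a \<theta>
      proof -
        have c: "0 \<le> 1 + cos u" for u :: real using cos_ge_minus_one[of u] by linarith
        have w: "0 \<le> P Z J A x * (1 + cos (S Z a x + \<theta>))"
            "P Z J A x * (1 + cos (S Z a x + \<theta>)) \<le> 2" for Z x
          using mult_mono[of "P Z J A x" 1 "1 + cos (S Z a x + \<theta>)" 2] P01 c by simp_all
        have char: "(CLINT x|M. complex_of_real (P X J A x * (1 + cos (S X a x + \<theta>))) * iexp (t * X j x))
          = (CLINT x|M. complex_of_real (P Y J A x * (1 + cos (S Y a x + \<theta>))) * iexp (t * Y j x))" for t
        proof -
          \<comment> \<open>\<open>d\<close> absorbs the frequency \<open>t\<close> of coordinate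
            \<open>j\<close> into the linear form. The three exponentials then have coefficients
            \<open>d\<close>, \<open>a + d\<close> and \<open>- a + d\<close>, all covered by the
            induction hypothesis.\<close>
          define d :: "'i \<Rightarrow> real" where "d = (\<lambda>i. if i = j then t else 0)"
          have S_d: "S Z d x = t * Z j x" "S Z (\<lambda>i. a i + d i) x = S Z a x + t * Z j x"
            "S Z (\<lambda>i. - a i + d i) x = - S Z a x + t * Z j x" for Z x
          proof -
            have "(\<Sum>i\<in>I. d i * Z i x) = (\<Sum>i\<in>I. if i = j then t * Z j x else 0)"
              unfolding d_def by (intro sum.cong) auto
            then show d: "S Z d x = t * Z j x" using insert fin by (simp add: S_def)
            show "S Z (\<lambda>i. a i + d i) x = S Z a x + t * Z j x"
              "S Z (\<lambda>i. - a i + d i) x = - S Z a x + t * Z j x"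
              unfolding d[symmetric] by (simp_all only: S_def ring_distribs sum.distrib sum_negf mult_minus_left)
          qed
          have "(CLINT x|M. complex_of_real (P Z J A x * (1 + cos (S Z a x + \<theta>))) * iexp (t * Z j x))
            = (CLINT x|M. P Z J A x * iexp (S Z d x))
              + (iexp \<theta> / 2) * (CLINT x|M. P Z J A x * iexp (S Z (\<lambda>i. a i + d i) x))
              + (iexp (-\<theta>) / 2) * (CLINT x|M. P Z J A x * iexp (S Z (\<lambda>i. - a i + d i) x))"
            if [measurable]: "P Z J A \<in> borel_measurable M" "\<And>a. S Z a \<in> borel_measurable M" for Z
          proof -
            have "(CLINT x|M. complex_of_real (P Z J A x * (1 + cos (S Z a x + \<theta>))) * iexp (t * Z j x))
              = (CLINT x|M. P Z J A x * iexp (S Z d x)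
              + (iexp \<theta> / 2) * (P Z J A x * iexp (S Z (\<lambda>i. a i + d i) x))
              + (iexp (-\<theta>) / 2) * (P Z J A x * iexp (S Z (\<lambda>i. - a i + d i) x)))"
              unfolding S_d cos_weight_mult_iexp ..
            moreover have "integrable M (\<lambda>x. P Z J A x * iexp (S Z a x))" for a
              by (intro bint nrm P01) measurable
            ultimately show ?thesis
              by (simp only: Bochner_Integration.integral_add Bochner_Integration.integrable_add
                  integrable_mult_right integral_mult_right_zero)
          qed
          from this[of X] this[of Y] show ?thesis by (simp add: IH)
        qed
        show ?thesis
          by (rule weighted_law_eqI[OF _ _ _ _ w w char]) measurable
      qed
      define Q where "Q = (\<lambda>Z x. P Z J A x * indicator (A j) (Z j x) :: real)"
      have Q: "P Z (insert j J) A x = Q Z x" for Z x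
        using insert by (simp add: P_def Q_def)
      have Q01: "0 \<le> Q Z x" "Q Z x \<le> 1" for Z x
        using P01[of Z "insert j J" A x] by (auto simp: Q)
      have [measurable]: "Q X \<in> borel_measurable M" "Q Y \<in> borel_measurable M"
        unfolding Q_def by measurable
      have nc: "\<bar>Q Z x * cos u\<bar> \<le> 2" "\<bar>Q Z x\<bar> \<le> 2" for Z x u
        using Q01[of Z x] mult_mono[of "\<bar>Q Z x\<bar>" 1 "\<bar>cos u\<bar>" 1] by (auto simp: abs_mult)
      \<comment> \<open>With zero coefficients and zero phase the weight \<open>1 + cos\<close> is
        the constant 2. Knowing the mean of \<open>Q\<close>, one can subtract it and keep only the
        cosine part.\<close>
      have Q_eq: "expectation (Q X) = expectation (Q Y)"
        using step[of "\<lambda>_. 0" 0] by (simp add: S_def Q_def mult_ac)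
      have cos_eq: "expectation (\<lambda>x. Q X x * cos (S X a x + \<theta>)) = expectation (\<lambda>x. Q Y x * cos (S Y a x + \<theta>))" for \<theta>
      proof -
        have "expectation (\<lambda>x. Q Z x + Q Z x * cos (S Z a x + \<theta>))
            = expectation (Q Z) + expectation (\<lambda>x. Q Z x * cos (S Z a x + \<theta>))"
          if [measurable]: "Q Z \<in> borel_measurable M" "S Z a \<in> borel_measurable M" for Z
          by (intro Bochner_Integration.integral_add rbint) (auto simp: nc)
        from this[of X] this[of Y] show ?thesis
          using step[of a \<theta>] Q_eq by (simp add: Q_def algebra_simps)
      qed
      have "(CLINT x|M. Q Z x * iexp (S Z a x))
         = expectation (\<lambda>x. Q Z x * cos (S Z a x + 0)) + \<i> * expectation (\<lambda>x. Q Z x * cos (S Z a x + -pi/2))"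
        if [measurable]: "Q Z \<in> borel_measurable M" "S Z a \<in> borel_measurable M" for Z
      proof -
        have "(CLINT x|M. Q Z x * iexp (S Z a x))
          = (CLINT x|M. of_real (Q Z x * cos (S Z a x + 0)) + \<i> * of_real (Q Z x * cos (S Z a x + -pi/2)))"
          unfolding mult_iexp_eq_cos ..
        also have "\<dots> = (CLINT x|M. of_real (Q Z x * cos (S Z a x + 0)))
            + (CLINT x|M. \<i> * of_real (Q Z x * cos (S Z a x + -pi/2)))"
          by (intro Bochner_Integration.integral_add integrable_mult_right integrable_of_real rbint)
             (auto simp: nc simp del: of_real_mult)
        finally show ?thesis by (simp del: of_real_mult)
      qed
      from this[of X] this[of Y] show ?case
        by (simp only: Q cos_eq) simp
    qed
  qed
  have meas: "(\<lambda>x. \<lambda>i\<in>I. Z i x) \<in> M \<rightarrow>\<^sub>M (\<Pi>\<^sub>M i\<in>I. borel)"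
    if "\<And>i. i \<in> I \<Longrightarrow> random_variable borel (Z i)" for Z :: "'i \<Rightarrow> 'a \<Rightarrow> real"
    using that by measurable
  \<comment> \<open>The sets outside \<open>I\<close> are replaced by \<open>{}\<close> because
    \<open>main\<close> asks for measurable sets at every index.\<close>
  have rect: "emeasure (distr M (\<Pi>\<^sub>M i\<in>I. borel) (\<lambda>x. \<lambda>i\<in>I. Z i x)) (Pi\<^sub>E I A)
      = ennreal (expectation (P Z I (\<lambda>i. if i \<in> I then A i else {})))"
    if A: "\<And>i. i \<in> I \<Longrightarrow> A i \<in> sets borel" and Z: "\<And>i. i \<in> I \<Longrightarrow> random_variable borel (Z i)" for Z A
  proof -
    have "(\<lambda>x. \<lambda>i\<in>I. Z i x) -` Pi\<^sub>E I A \<inter> space M \<in> events"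
      using meas[OF Z] A fin by (auto intro!: measurable_sets sets_PiM_I_finite)
    moreover have "indicator ((\<lambda>x. \<lambda>i\<in>I. Z i x) -` Pi\<^sub>E I A \<inter> space M) x = P Z I (\<lambda>i. if i \<in> I then A i else {}) x"
      if x: "x \<in> space M" for x
    proof (cases "\<forall>i\<in>I. Z i x \<in> A i")
      case True
      then have "P Z I (\<lambda>i. if i \<in> I then A i else {}) x = 1"
        unfolding P_def by (intro prod.neutral) simp
      with True x show ?thesis by (simp add: indicator_def)
    next
      case False
      then obtain i where "i \<in> I" "Z i x \<notin> A i" by blast
      then have "P Z I (\<lambda>i. if i \<in> I then A i else {}) x = 0"
        unfolding P_def using fin by (intro prod_zero bexI[of _ i]) auto
      with False show ?thesis by (auto simp: indicator_def PiE_iff)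
    qed
    then have "expectation (P Z I (\<lambda>i. if i \<in> I then A i else {}))
        = expectation (indicator ((\<lambda>x. \<lambda>i\<in>I. Z i x) -` Pi\<^sub>E I A \<inter> space M))"
      by (intro Bochner_Integration.integral_cong) auto
    ultimately show ?thesis
      using A fin meas[OF Z] by (subst emeasure_distr) (auto simp: emeasure_eq_measure intro!: sets_PiM_I_finite)
  qed
  show ?thesis
  \<comment> \<open>Rectangles generate the product sigma-algebra and are stable under intersection;
    the whole space has finite mass and serves as a constant exhausting sequence.\<close>
  proof (rule measure_eqI_PiM_finite[OF fin, where A = "\<lambda>_. \<Pi>\<^sub>E i\<in>I. UNIV"])
    fix A :: "'i \<Rightarrow> real set" assume A: "\<And>i. i \<in> I \<Longrightarrow> A i \<in> sets borel"
    show "emeasure (distr M (\<Pi>\<^sub>M i\<in>I. borel) (\<lambda>x. \<lambda>i\<in>I. X i x)) (Pi\<^sub>E I A)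
      = emeasure (distr M (\<Pi>\<^sub>M i\<in>I. borel) (\<lambda>x. \<lambda>i\<in>I. Y i x)) (Pi\<^sub>E I A)"
      using main[of I "\<lambda>i. if i \<in> I then A i else {}" "\<lambda>_. 0"] A
      by (simp add: rect X Y S_def)
  next
    show "range (\<lambda>_::nat. \<Pi>\<^sub>E i\<in>I. UNIV) \<subseteq> prod_algebra I (\<lambda>i. borel :: real measure)"
      using fin by (auto intro!: prod_algebraI_finite)
    interpret D: prob_space "distr M (\<Pi>\<^sub>M i\<in>I. borel) (\<lambda>x. \<lambda>i\<in>I. X i x)"
      by (intro prob_space_distr meas X)
    show "emeasure (distr M (\<Pi>\<^sub>M i\<in>I. borel) (\<lambda>x. \<lambda>i\<in>I. X i x)) (\<Pi>\<^sub>E i\<in>I. UNIV) \<noteq> \<infinity>"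
      by simp
  qed (auto simp: space_PiM)
qed

subsection \<open>Gaussian vectors\<close>

lemma gaussian_rv_integrable:
  assumes "gaussian_rv M Z"
  shows "integrable M Z" "integrable M (\<lambda>x. (Z x)\<^sup>2)"
proof -
  consider \<mu> \<sigma> where "\<sigma> > 0" "distributed M lborel Z (normal_density \<mu> \<sigma>)"
    | \<mu> where "Z \<in> borel_measurable M" "AE x in M. Z x = \<mu>"
    using assms unfolding gaussian_rv_def by blast
  then have "integrable M Z \<and> integrable M (\<lambda>x. (Z x)\<^sup>2)"
  proof cases
    case 1
    have 2: "integrable lborel (\<lambda>x. normal_density \<mu> \<sigma> x * x)"
      using 1 by (simp add: integrable_normal_moment_nz_1)
    \<comment> \<open>The second moment is recovered from central ones: x^2 = (x - \<mu>)^2 + 2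
      \<mu> x - \<mu>^2.\<close>
    have "integrable lborel (\<lambda>x. normal_density \<mu> \<sigma> x * (x - \<mu>)^2 + 2 * \<mu> * (normal_density \<mu> \<sigma> x * x) - \<mu>^2 * normal_density \<mu> \<sigma> x)"
      using 1 2 integrable_normal_moment[of \<sigma> \<mu> 2]
      by (intro Bochner_Integration.integrable_diff Bochner_Integration.integrable_add
           integrable_mult_right) auto
    also have "(\<lambda>x. normal_density \<mu> \<sigma> x * (x - \<mu>)^2 + 2 * \<mu> * (normal_density \<mu> \<sigma> x * x) - \<mu>^2 * normal_density \<mu> \<sigma> x)
        = (\<lambda>x. normal_density \<mu> \<sigma> x * x^2)"
      by (simp add: fun_eq_iff power2_eq_square algebra_simps)
    finally show ?thesis
      using 2 distributed_integrable[OF 1(2), of "\<lambda>x. x^2"] distributed_integrable[OF 1(2), of "\<lambda>x. x"]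
      by simp
  next
    case 2
    then have "integrable M Z \<longleftrightarrow> integrable M (\<lambda>_. \<mu>)" "integrable M (\<lambda>x. (Z x)\<^sup>2) \<longleftrightarrow> integrable M (\<lambda>_. \<mu>\<^sup>2)"
      by (intro integrable_cong_AE; auto)+
    then show ?thesis by simp
  qed
  then show "integrable M Z" "integrable M (\<lambda>x. (Z x)\<^sup>2)" by auto
qed

text \<open>A nondegenerate \<open>Z\<close> is \<sigma> times a standard normal variable, whose
  characteristic function is evaluated at \<sigma>. A degenerate one is almost surely 0, and both
  sides are 1.\<close>

lemma gaussian_rv_char:
  assumes "gaussian_rv M Z" and "expectation Z = 0"
  shows "(CLINT x|M. iexp (Z x)) = complex_of_real (exp (- expectation (\<lambda>x. (Z x)\<^sup>2) / 2))"
proof -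
  consider \<mu> \<sigma> where "\<sigma> > 0" "distributed M lborel Z (normal_density \<mu> \<sigma>)"
    | \<mu> where "Z \<in> borel_measurable M" "AE x in M. Z x = \<mu>"
    using assms unfolding gaussian_rv_def by blast
  then show ?thesis
  proof cases
    case 1
    then have \<mu>: "\<mu> = 0" using normal_distributed_expectation assms by auto
    have var: "expectation (\<lambda>x. (Z x)\<^sup>2) = \<sigma>\<^sup>2"
      using normal_distributed_variance[OF 1] assms by simp
    have [measurable]: "random_variable borel Z"
      using distributed_measurable[OF 1(2)] by simp
    have D: "distributed M lborel (\<lambda>x. Z x / \<sigma>) std_normal_density"
      using normal_standard_normal_convert[OF 1(1), of Z \<mu>] 1 \<mu> by simp
    have "char std_normal_distribution \<sigma> = char (distr M lborel (\<lambda>x. Z x / \<sigma>)) \<sigma>"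
      using distributed_distr_eq_density[OF D] by simp
    also have "\<dots> = (CLINT x|M. iexp (Z x))"
      unfolding char_def using 1 by (subst integral_distr) auto
    finally show ?thesis by (simp add: char_std_normal_distribution var)
  next
    case 2
    then have "expectation Z = expectation (\<lambda>_. \<mu>)"
      by (intro integral_cong_AE) auto
    then have \<mu>: "\<mu> = 0" using assms by (simp add: prob_space)
    have "expectation (\<lambda>x. (Z x)\<^sup>2) = expectation (\<lambda>_. 0)"
      "(CLINT x|M. iexp (Z x)) = (CLINT x|M. 1)"
      using 2 \<mu> by (intro integral_cong_AE; auto)+
    then show ?thesis by (simp add: prob_space)
  qed
qed

text \<open>A linear form with a single coefficient 1 shows each coordinate to be Gaussian, hence
  square integrable; products are dominated by sums of squares.\<close>

lemma centered_gaussian_vector_integrable: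
  assumes "finite I" "centered_gaussian_vector M I X C" "i \<in> I" "j \<in> I"
  shows "integrable M (X i)" "integrable M (\<lambda>x. X i x * X j x)"
proof -
  have *: "integrable M (X i) \<and> integrable M (\<lambda>x. (X i x)\<^sup>2)" if "i \<in> I" for i
  proof -
    have "gaussian_rv M (\<lambda>x. \<Sum>k\<in>I. (if k = i then 1 else 0) * X k x)"
      using assms(2) unfolding centered_gaussian_vector_def
      by (auto dest: spec[where x = "\<lambda>k. if k = i then 1 else 0"])
    also have "(\<lambda>x. \<Sum>k\<in>I. (if k = i then 1 else 0) * X k x) = X i"
      using that \<open>finite I\<close> by (simp add: if_distrib[of "\<lambda>u. u * _"] cong: if_cong)
    finally show ?thesis using gaussian_rv_integrable by blast
  qed
  show "integrable M (X i)" using * assms by auto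
  have [measurable]: "random_variable borel (X i)" "random_variable borel (X j)"
    using assms unfolding centered_gaussian_vector_def by auto
  show "integrable M (\<lambda>x. X i x * X j x)"
  proof (rule Bochner_Integration.integrable_bound)
    show "integrable M (\<lambda>x. (X i x)\<^sup>2 + (X j x)\<^sup>2)" using * assms by auto
    have "\<bar>u * v\<bar> \<le> u\<^sup>2 + v\<^sup>2" for u v :: real
      using sum_squares_bound[of "\<bar>u\<bar>" "\<bar>v\<bar>"] abs_ge_zero[of "u * v"]
      unfolding abs_mult power2_abs by linarith
    then show "AE x in M. norm (X i x * X j x) \<le> norm ((X i x)\<^sup>2 + (X j x)\<^sup>2)"
      by auto
  qed simp
qed

text \<open>The linear form is itself a centered Gaussian variable, and its variance is the
  quadratic form of \<open>C\<close> at \<open>a\<close>.\<close>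

lemma centered_gaussian_vector_char:
  assumes "finite I" "centered_gaussian_vector M I X C"
  shows "(CLINT x|M. iexp (\<Sum>i\<in>I. a i * X i x))
    = complex_of_real (exp (- (\<Sum>i\<in>I. \<Sum>j\<in>I. a i * a j * C i j) / 2))"
proof -
  have C: "\<And>i. i \<in> I \<Longrightarrow> expectation (X i) = 0"
    "\<And>i j. i \<in> I \<Longrightarrow> j \<in> I \<Longrightarrow> expectation (\<lambda>x. X i x * X j x) = C i j"
    "gaussian_rv M (\<lambda>x. \<Sum>i\<in>I. a i * X i x)"
    using assms unfolding centered_gaussian_vector_def by auto
  note int = centered_gaussian_vector_integrable[OF assms]
  have mean: "expectation (\<lambda>x. \<Sum>i\<in>I. a i * X i x) = 0"
    using int C by (subst Bochner_Integration.integral_sum) auto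
  have "expectation (\<lambda>x. (\<Sum>i\<in>I. a i * X i x)\<^sup>2)
      = expectation (\<lambda>x. \<Sum>i\<in>I. \<Sum>j\<in>I. (a i * a j) * (X i x * X j x))"
    by (intro Bochner_Integration.integral_cong) (auto simp: power2_eq_square sum_product mult_ac)
  also have "\<dots> = (\<Sum>i\<in>I. \<Sum>j\<in>I. a i * a j * C i j)"
    using int C
    by (subst Bochner_Integration.integral_sum, (intro Bochner_Integration.integrable_sum integrable_mult_right; simp))
       (intro sum.cong refl, subst Bochner_Integration.integral_sum, auto)
  finally show ?thesis
    using gaussian_rv_char[OF C(3) mean] by simp
qed

end

section \<open>Gibbs expectations as functions of the inverse temperature\<close>

lemma finite_configs [simp]: "finite (configs N)"
  by (auto simp: configs_def intro!: finite_PiE)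

lemma configs_nonempty [simp]: "configs N \<noteq> {}"
  by (auto simp: configs_def PiE_eq_empty_iff)

lemma partition_fun_pos: "partition_fun N h b > 0"
  unfolding partition_fun_def by (intro sum_pos) auto

lemma gibbs_pos: "gibbs N h b \<sigma> > 0"
  unfolding gibbs_def using partition_fun_pos by simp

lemma sum_gibbs: "(\<Sum>\<sigma>\<in>configs N. gibbs N h b \<sigma>) = 1"
  using partition_fun_pos[of N h b]
  by (simp add: gibbs_def partition_fun_def flip: sum_divide_distrib)

section \<open>Thermal mean and variance, and convexity of the log partition function\<close>

definition gibbs_mean :: "nat \<Rightarrow> (config \<Rightarrow> real) \<Rightarrow> real \<Rightarrow> real" where
  "gibbs_mean N h b = (\<Sum>\<sigma>\<in>configs N. gibbs N h b \<sigma> * h \<sigma>)"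

definition gibbs_variance :: "nat \<Rightarrow> (config \<Rightarrow> real) \<Rightarrow> real \<Rightarrow> real" where
  "gibbs_variance N h b = (\<Sum>\<sigma>\<in>configs N. gibbs N h b \<sigma> * (h \<sigma> - gibbs_mean N h b)\<^sup>2)"

lemma partition_fun_deriv:
  "(partition_fun N h has_real_derivative partition_fun N h b * gibbs_mean N h b) (at b)"
proof -
  have "partition_fun N h b * gibbs_mean N h b = (\<Sum>\<sigma>\<in>configs N. exp (b * h \<sigma>) * h \<sigma>)"
    using partition_fun_pos[of N h b] by (simp add: gibbs_mean_def gibbs_def sum_distrib_left)
  then show ?thesis
    unfolding partition_fun_def [abs_def] by (auto intro!: derivative_eq_intros sum.cong)
qed

lemma ln_partition_fun_deriv:
  "((\<lambda>b. ln (partition_fun N h b)) has_real_derivative gibbs_mean N h b) (at b)"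
  using partition_fun_pos[of N h b]
  by (auto intro!: derivative_eq_intros partition_fun_deriv)

lemma gibbs_deriv:
  "((\<lambda>b. gibbs N h b \<sigma>) has_real_derivative gibbs N h b \<sigma> * (h \<sigma> - gibbs_mean N h b)) (at b)"
  unfolding gibbs_def using partition_fun_pos[of N h b]
  by (auto intro!: derivative_eq_intros partition_fun_deriv simp: field_simps)

text \<open>Differentiating the weights gives the Gibbs covariance of \<open>h - ?m\<close> with
  \<open>h\<close>. Since \<open>h - ?m\<close> has Gibbs mean 0, the second factor may be centered
  as well.\<close>

lemma gibbs_mean_deriv: "(gibbs_mean N h has_real_derivative gibbs_variance N h b) (at b)"
proof -
  let ?m = "gibbs_mean N h b"
  have "gibbs_variance N h b
      = (\<Sum>\<sigma>\<in>configs N. gibbs N h b \<sigma> * (h \<sigma> - ?m) * h \<sigma>) - ?m * (\<Sum>\<sigma>\<in>configs N. gibbs N h b \<sigma> * (h \<sigma> - ?m))"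
    unfolding gibbs_variance_def sum_distrib_left sum_subtractf [symmetric]
    by (intro sum.cong) (auto simp: power2_eq_square algebra_simps)
  also have "(\<Sum>\<sigma>\<in>configs N. gibbs N h b \<sigma> * (h \<sigma> - ?m)) = 0"
    by (simp add: right_diff_distrib sum_subtractf sum_gibbs gibbs_mean_def flip: sum_distrib_right)
  finally show ?thesis
    unfolding gibbs_mean_def [abs_def]
    by (auto intro!: derivative_eq_intros gibbs_deriv sum.cong simp: gibbs_mean_def)
qed

lemma gibbs_variance_nonneg: "gibbs_variance N h b \<ge> 0"
  unfolding gibbs_variance_def using gibbs_pos by (intro sum_nonneg) (simp add: less_imp_le)

text \<open>This is convexity of the log partition function, whose second derivative is a
  variance.\<close>

lemma gibbs_mean_mono: "b \<le> b' \<Longrightarrow> gibbs_mean N h b \<le> gibbs_mean N h b'"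
  by (rule DERIV_nonneg_imp_nondecreasing) (use gibbs_mean_deriv gibbs_variance_nonneg in blast)+

text \<open>By the mean value theorem the increment is \<delta> times the Gibbs mean at a point to
  the right (respectively left) of \<open>b\<close>, and that mean is nondecreasing. These are the
  convexity bounds by difference quotients.\<close>

lemma ln_partition_fun_increment:
  assumes "\<delta> > 0"
  shows "\<delta> * gibbs_mean N h b \<le> ln (partition_fun N h (b + \<delta>)) - ln (partition_fun N h b)"
    and "ln (partition_fun N h b) - ln (partition_fun N h (b - \<delta>)) \<le> \<delta> * gibbs_mean N h b"
proof -
  obtain z where "b < z"
    "ln (partition_fun N h (b + \<delta>)) - ln (partition_fun N h b) = (b + \<delta> - b) * gibbs_mean N h z"
    using MVT2[of b "b + \<delta>" "\<lambda>b. ln (partition_fun N h b)" "gibbs_mean N h"] assms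
      ln_partition_fun_deriv by auto
  then show "\<delta> * gibbs_mean N h b \<le> ln (partition_fun N h (b + \<delta>)) - ln (partition_fun N h b)"
    using assms gibbs_mean_mono[of b z N h] by simp
  obtain z where "z < b"
    "ln (partition_fun N h b) - ln (partition_fun N h (b - \<delta>)) = (b - (b - \<delta>)) * gibbs_mean N h z"
    using MVT2[of "b - \<delta>" b "\<lambda>b. ln (partition_fun N h b)" "gibbs_mean N h"] assms
      ln_partition_fun_deriv by auto
  then show "ln (partition_fun N h b) - ln (partition_fun N h (b - \<delta>)) \<le> \<delta> * gibbs_mean N h b"
    using assms gibbs_mean_mono[of z b N h] by simp
qed

section \<open>Sensitivity of replica expectations to the inverse temperature\<close>

lemma gibbs_expectation_deriv:
  "((\<lambda>b. gibbs_expectation N h b s f) has_real_derivative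
     (\<Sum>\<sigma>\<in>{1..s} \<rightarrow>\<^sub>E configs N. f \<sigma> * (\<Prod>k\<in>{1..s}. gibbs N h b (\<sigma> k))
        * (\<Sum>k\<in>{1..s}. h (\<sigma> k) - gibbs_mean N h b))) (at b)"
proof -
  have nz: "gibbs N h b \<sigma> \<noteq> 0" for \<sigma> using gibbs_pos[of N h b \<sigma>] by simp
  \<comment> \<open>Logarithmic derivatives add over the replicas, and each weight contributes
    \<open>h (\<sigma> k) - gibbs_mean N h b\<close>.\<close>
  have "((\<lambda>b. \<Prod>k\<in>{1..s}. gibbs N h b (\<sigma> k)) has_real_derivative
      (\<Prod>k\<in>{1..s}. gibbs N h b (\<sigma> k)) * (\<Sum>k\<in>{1..s}. h (\<sigma> k) - gibbs_mean N h b)) (at b)" for \<sigma>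
    using has_field_derivative_prod'[of "{1..s}" "\<lambda>k b. gibbs N h b (\<sigma> k)" b
        "\<lambda>k. gibbs N h b (\<sigma> k) * (h (\<sigma> k) - gibbs_mean N h b)"] gibbs_deriv nz
    by simp
  from DERIV_cmult[OF this] show ?thesis
    unfolding gibbs_expectation_def by (intro DERIV_sum) (simp add: mult.assoc)
qed

text \<open>The replicas are independent under the product measure: the sum factorises, and every
  factor except the \<open>j\<close>-th sums to 1.\<close>

lemma gibbs_marginal:
  fixes u :: "config \<Rightarrow> real" and s :: nat
  assumes "j \<in> {1..s}"
  shows "(\<Sum>\<sigma>\<in>{1..s} \<rightarrow>\<^sub>E configs N. (\<Prod>k\<in>{1..s}. gibbs N h b (\<sigma> k)) * u (\<sigma> j))
    = (\<Sum>\<tau>\<in>configs N. gibbs N h b \<tau> * u \<tau>)"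
proof -
  have "(\<Sum>\<sigma>\<in>{1..s} \<rightarrow>\<^sub>E configs N. (\<Prod>k\<in>{1..s}. gibbs N h b (\<sigma> k)) * u (\<sigma> j))
    = (\<Sum>\<sigma>\<in>{1..s} \<rightarrow>\<^sub>E configs N. \<Prod>k\<in>{1..s}. gibbs N h b (\<sigma> k) * (if k = j then u (\<sigma> k) else 1))"
  proof (intro sum.cong refl)
    fix \<sigma>
    have "(\<Prod>k\<in>{1..s}. if k = j then u (\<sigma> k) else 1) = (\<Prod>k\<in>{1..s}. if k = j then u (\<sigma> j) else 1)"
      by (intro prod.cong) auto
    then show "(\<Prod>k\<in>{1..s}. gibbs N h b (\<sigma> k)) * u (\<sigma> j)
        = (\<Prod>k\<in>{1..s}. gibbs N h b (\<sigma> k) * (if k = j then u (\<sigma> k) else 1))"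
      using assms by (simp add: prod.distrib prod.delta)
  qed
  also have "\<dots> = (\<Prod>k\<in>{1..s}. \<Sum>\<tau>\<in>configs N. gibbs N h b \<tau> * (if k = j then u \<tau> else 1))"
    by (subst prod_sum_PiE) auto
  also have "\<dots> = (\<Prod>k\<in>{1..s}. if k = j then \<Sum>\<tau>\<in>configs N. gibbs N h b \<tau> * u \<tau> else 1)"
    by (intro prod.cong) (auto simp: sum_gibbs)
  finally show ?thesis using assms by (simp add: prod.delta)
qed

text \<open>The arithmetic-geometric mean inequality |x| \<le> (x^2 / t + t) / 2 trades absolute
  deviations for variances, and each of the \<open>s\<close> replicas contributes the same
  one-replica marginal. The scale \<open>t\<close> stays free for later balancing.\<close>

lemma gibbs_expectation_deriv_bound:
  fixes s :: nat
  assumes "t > 0" and B: "\<And>\<sigma>. \<sigma> \<in> {1..s} \<rightarrow>\<^sub>E configs N \<Longrightarrow> \<bar>f \<sigma>\<bar> \<le> B"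
  shows "\<bar>\<Sum>\<sigma>\<in>{1..s} \<rightarrow>\<^sub>E configs N. f \<sigma> * (\<Prod>k\<in>{1..s}. gibbs N h b (\<sigma> k))
        * (\<Sum>k\<in>{1..s}. h (\<sigma> k) - gibbs_mean N h b)\<bar>
    \<le> B * s / 2 * (gibbs_variance N h b / t + t)"
proof -
  let ?m = "gibbs_mean N h b"
  let ?P = "\<lambda>\<sigma>. \<Prod>k\<in>{1..s}. gibbs N h b (\<sigma> k)"
  have P: "?P \<sigma> \<ge> 0" for \<sigma> using gibbs_pos by (intro prod_nonneg) (simp add: less_imp_le)
  have AMGM: "\<bar>x\<bar> \<le> (x\<^sup>2 / t + t) / 2" for x
    using sum_squares_bound[of "\<bar>x\<bar>" t] \<open>t > 0\<close> by (simp add: field_simps power2_eq_square)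
  have "\<bar>\<Sum>\<sigma>\<in>{1..s} \<rightarrow>\<^sub>E configs N. f \<sigma> * ?P \<sigma> * (\<Sum>k\<in>{1..s}. h (\<sigma> k) - ?m)\<bar>
      \<le> (\<Sum>\<sigma>\<in>{1..s} \<rightarrow>\<^sub>E configs N. B * (?P \<sigma> * (\<Sum>k\<in>{1..s}. ((h (\<sigma> k) - ?m)\<^sup>2 / t + t) / 2)))"
  proof (rule order.trans[OF sum_abs sum_mono])
    fix \<sigma> assume \<sigma>: "\<sigma> \<in> {1..s} \<rightarrow>\<^sub>E configs N"
    have "\<bar>\<Sum>k\<in>{1..s}. h (\<sigma> k) - ?m\<bar> \<le> (\<Sum>k\<in>{1..s}. ((h (\<sigma> k) - ?m)\<^sup>2 / t + t) / 2)"
      by (rule order.trans[OF sum_abs sum_mono]) (rule AMGM)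
    then have "\<bar>f \<sigma>\<bar> * (?P \<sigma> * \<bar>\<Sum>k\<in>{1..s}. h (\<sigma> k) - ?m\<bar>)
        \<le> B * (?P \<sigma> * (\<Sum>k\<in>{1..s}. ((h (\<sigma> k) - ?m)\<^sup>2 / t + t) / 2))"
      using B[OF \<sigma>] P by (intro mult_mono mult_left_mono mult_nonneg_nonneg) auto
    then show "\<bar>f \<sigma> * ?P \<sigma> * (\<Sum>k\<in>{1..s}. h (\<sigma> k) - ?m)\<bar>
        \<le> B * (?P \<sigma> * (\<Sum>k\<in>{1..s}. ((h (\<sigma> k) - ?m)\<^sup>2 / t + t) / 2))"
      using P[of \<sigma>] by (simp add: abs_mult mult.assoc)
  qed
  also have "\<dots> = B * (\<Sum>k\<in>{1..s}. \<Sum>\<sigma>\<in>{1..s} \<rightarrow>\<^sub>E configs N. ?P \<sigma> * (((h (\<sigma> k) - ?m)\<^sup>2 / t + t) / 2))"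
    by (subst sum.swap) (simp only: sum_distrib_left)
  also have "\<dots> = B * (\<Sum>k\<in>{1..s}. \<Sum>\<tau>\<in>configs N. gibbs N h b \<tau> * (((h \<tau> - ?m)\<^sup>2 / t + t) / 2))"
    by (intro arg_cong2[where f = "(*)"] sum.cong refl gibbs_marginal)
  also have "(\<Sum>\<tau>\<in>configs N. gibbs N h b \<tau> * (((h \<tau> - ?m)\<^sup>2 / t + t) / 2)) = (gibbs_variance N h b / t + t) / 2"
  proof -
    have "(\<Sum>\<tau>\<in>configs N. gibbs N h b \<tau> * (((h \<tau> - ?m)\<^sup>2 / t + t) / 2))
      = (\<Sum>\<tau>\<in>configs N. gibbs N h b \<tau> * (h \<tau> - ?m)\<^sup>2 / (2 * t) + gibbs N h b \<tau> * (t / 2))"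
      using \<open>t > 0\<close> by (intro sum.cong) (auto simp: field_simps)
    also have "\<dots> = gibbs_variance N h b / (2 * t) + t / 2"
      by (simp add: sum.distrib gibbs_variance_def sum_gibbs flip: sum_divide_distrib sum_distrib_right)
    finally show ?thesis using \<open>t > 0\<close> by (simp add: field_simps)
  qed
  finally show ?thesis by simp
qed

text \<open>The derivative bound is integrated by comparison with an explicit antiderivative
  \<open>K\<close>: both \<open>K - G\<close> and \<open>K + G\<close> are nondecreasing, where
  \<open>G\<close> is the replica expectation. Convexity then replaces Gibbs means by increments of
  the log partition function.\<close>

lemma gibbs_expectation_increment:
  fixes s :: nat
  assumes "t > 0" "\<delta> > 0" "\<beta> \<le> \<beta>'" "\<beta>' \<le> \<beta> + \<delta>"
    and B: "\<And>\<sigma>. \<sigma> \<in> {1..s} \<rightarrow>\<^sub>E configs N \<Longrightarrow> \<bar>f \<sigma>\<bar> \<le> B"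
  shows "\<bar>gibbs_expectation N h \<beta>' s f - gibbs_expectation N h \<beta> s f\<bar>
    \<le> B * s / 2 * ((ln (partition_fun N h (\<beta> + 2 * \<delta>)) - ln (partition_fun N h (\<beta> + \<delta>))
        - ln (partition_fun N h \<beta>) + ln (partition_fun N h (\<beta> - \<delta>))) / (\<delta> * t) + t * (\<beta>' - \<beta>))"
proof -
  have "({1..s} \<rightarrow>\<^sub>E configs N) \<noteq> {}" by (simp add: PiE_eq_empty_iff)
  then have B0: "B \<ge> 0" using B abs_ge_zero order_trans by blast
  define K where "K b = B * s / 2 * (gibbs_mean N h b / t + t * b)" for b
  define D where "D b = (\<Sum>\<sigma>\<in>{1..s} \<rightarrow>\<^sub>E configs N. f \<sigma> * (\<Prod>k\<in>{1..s}. gibbs N h b (\<sigma> k))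
        * (\<Sum>k\<in>{1..s}. h (\<sigma> k) - gibbs_mean N h b))" for b
  have D: "((\<lambda>b. gibbs_expectation N h b s f) has_real_derivative D b) (at b)" for b
    unfolding D_def by (rule gibbs_expectation_deriv)
  have K: "(K has_real_derivative B * s / 2 * (gibbs_variance N h b / t + t)) (at b)" for b
    unfolding K_def [abs_def] using \<open>t > 0\<close>
    by (auto intro!: derivative_eq_intros gibbs_mean_deriv simp: field_simps)
  have bd: "\<bar>D b\<bar> \<le> B * s / 2 * (gibbs_variance N h b / t + t)" for b
    unfolding D_def using assms by (intro gibbs_expectation_deriv_bound)
  have "K \<beta> - gibbs_expectation N h \<beta> s f \<le> K \<beta>' - gibbs_expectation N h \<beta>' s f"
  proof (rule DERIV_nonneg_imp_nondecreasing[OF \<open>\<beta> \<le> \<beta>'\<close>])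
    show "\<exists>y. ((\<lambda>b. K b - gibbs_expectation N h b s f) has_real_derivative y) (at b) \<and> 0 \<le> y" for b
      by (rule exI, rule conjI, rule DERIV_diff[OF K D]) (use bd[of b] in linarith)
  qed
  moreover have "K \<beta> + gibbs_expectation N h \<beta> s f \<le> K \<beta>' + gibbs_expectation N h \<beta>' s f"
  proof (rule DERIV_nonneg_imp_nondecreasing[OF \<open>\<beta> \<le> \<beta>'\<close>])
    show "\<exists>y. ((\<lambda>b. K b + gibbs_expectation N h b s f) has_real_derivative y) (at b) \<and> 0 \<le> y" for b
      by (rule exI, rule conjI, rule DERIV_add[OF K D]) (use bd[of b] in linarith)
  qed
  ultimately have "\<bar>gibbs_expectation N h \<beta>' s f - gibbs_expectation N h \<beta> s f\<bar> \<le> K \<beta>' - K \<beta>"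
    by linarith
  \<comment> \<open>Expanding by \<delta> prepares the Gibbs means for comparison with increments
    over intervals of length \<delta>.\<close>
  also have "\<dots> = B * s / 2 * ((\<delta> * gibbs_mean N h \<beta>' - \<delta> * gibbs_mean N h \<beta>) / (\<delta> * t) + t * (\<beta>' - \<beta>))"
    using assms by (simp add: K_def field_simps)
  also have "\<dots> \<le> B * s / 2 * ((\<delta> * gibbs_mean N h (\<beta> + \<delta>) - \<delta> * gibbs_mean N h \<beta>) / (\<delta> * t) + t * (\<beta>' - \<beta>))"
    using assms B0 by (intro mult_left_mono add_right_mono divide_right_mono diff_right_mono gibbs_mean_mono) auto
  \<comment> \<open>The mean at \<beta> + \<delta> is bounded above by the increment over the
    interval to its right, the mean at \<beta> below by the one over the interval to its left; hence
    the four evaluation points.\<close>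
  also have "\<dots> \<le> B * s / 2 * ((ln (partition_fun N h (\<beta> + 2 * \<delta>)) - ln (partition_fun N h (\<beta> + \<delta>))
        - ln (partition_fun N h \<beta>) + ln (partition_fun N h (\<beta> - \<delta>))) / (\<delta> * t) + t * (\<beta>' - \<beta>))"
    using assms B0 ln_partition_fun_increment(1)[OF \<open>\<delta> > 0\<close>, of N h "\<beta> + \<delta>"]
      ln_partition_fun_increment(2)[OF \<open>\<delta> > 0\<close>, of N h \<beta>]
    by (intro mult_left_mono add_right_mono divide_right_mono) (auto simp: algebra_simps)
  finally show ?thesis .
qed

section \<open>Change of the Hamiltonian: congruence, rescaling and tilting\<close>

lemma gibbs_cong:
  assumes "\<And>\<tau>. \<tau> \<in> configs N \<Longrightarrow> h \<tau> = h' \<tau>" "\<sigma> \<in> configs N"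
  shows "gibbs N h b \<sigma> = gibbs N h' b \<sigma>"
  unfolding gibbs_def partition_fun_def using assms
  by (intro arg_cong2[where f = "(/)"] sum.cong) auto

lemma gibbs_expectation_cong:
  assumes "\<And>\<tau>. \<tau> \<in> configs N \<Longrightarrow> h \<tau> = h' \<tau>"
  shows "gibbs_expectation N h b s f = gibbs_expectation N h' b s f"
  unfolding gibbs_expectation_def using assms
  by (intro sum.cong refl arg_cong2[where f = "(*)"] prod.cong gibbs_cong) auto

lemma gibbs_expectation_one: "gibbs_expectation N h b s (\<lambda>_. 1) = 1"
proof -
  have "gibbs_expectation N h b s (\<lambda>_. 1) = (\<Prod>k\<in>{1..s}. \<Sum>\<tau>\<in>configs N. gibbs N h b \<tau>)"
    unfolding gibbs_expectation_def by (subst prod_sum_PiE) auto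
  then show ?thesis by (simp add: sum_gibbs)
qed

lemma gibbs_rescale: "gibbs N (\<lambda>\<tau>. b * h \<tau>) 1 = gibbs N h b"
  by (simp add: fun_eq_iff gibbs_def partition_fun_def)

text \<open>Tilting multiplies each Gibbs weight into one for the Hamiltonian
  \<open>b * h + c * u\<close>, up to a ratio \<open>q\<close> of partition functions that does not
  depend on the configuration. The factor \<open>q ^ s\<close> cancels in the quotient.\<close>

lemma gibbs_expectation_tilt:
  "gibbs_expectation N h b s (\<lambda>\<sigma>. f \<sigma> * (\<Prod>k\<in>{1..s}. exp (c * u (\<sigma> k))))
     / gibbs_expectation N h b s (\<lambda>\<sigma>. \<Prod>k\<in>{1..s}. exp (c * u (\<sigma> k)))
   = gibbs_expectation N (\<lambda>\<tau>. b * h \<tau> + c * u \<tau>) 1 s f"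
proof -
  define g where "g = (\<lambda>\<tau>. b * h \<tau> + c * u \<tau>)"
  define q where "q = partition_fun N g 1 / partition_fun N h b"
  have q: "q > 0" unfolding q_def using partition_fun_pos by simp
  have "exp (c * u \<tau>) * gibbs N h b \<tau> = q * gibbs N g 1 \<tau>" for \<tau>
    using partition_fun_pos[of N g 1] by (simp add: q_def g_def gibbs_def exp_add)
  then have "(\<Prod>k\<in>{1..s}. exp (c * u (\<sigma> k))) * (\<Prod>k\<in>{1..s}. gibbs N h b (\<sigma> k))
      = q ^ s * (\<Prod>k\<in>{1..s}. gibbs N g 1 (\<sigma> k))" for \<sigma> :: "nat \<Rightarrow> config"
    by (subst prod.distrib [symmetric]) (simp add: prod.distrib)
  then have tilt: "gibbs_expectation N h b s (\<lambda>\<sigma>. f \<sigma> * (\<Prod>k\<in>{1..s}. exp (c * u (\<sigma> k))))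
      = q ^ s * gibbs_expectation N g 1 s f" for f
    unfolding gibbs_expectation_def sum_distrib_left
    by (intro sum.cong) (auto simp: mult.assoc mult.left_commute[of "q ^ s"])
  show ?thesis
    using tilt[of f] tilt[of "\<lambda>_. 1"] q unfolding g_def [symmetric] by (simp add: gibbs_expectation_one)
qed

section \<open>Measurability and boundedness of Gibbs weights\<close>

lemma gibbs_measurable:
  assumes H: "\<And>\<tau>. \<tau> \<in> configs N \<Longrightarrow> H \<tau> \<in> borel_measurable M" and "\<sigma> \<in> configs N"
  shows "(\<lambda>\<omega>. gibbs N (\<lambda>\<tau>. H \<tau> \<omega>) b \<sigma>) \<in> borel_measurable M"
proof -
  note [measurable] = H
  have [measurable]: "(\<lambda>\<omega>. H \<sigma> \<omega>) \<in> borel_measurable M" using assms by simp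
  show ?thesis unfolding gibbs_def partition_fun_def by measurable
qed

lemma gibbs_expectation_measurable:
  assumes H: "\<And>\<tau>. \<tau> \<in> configs N \<Longrightarrow> H \<tau> \<in> borel_measurable M"
  shows "(\<lambda>\<omega>. gibbs_expectation N (\<lambda>\<tau>. H \<tau> \<omega>) b s f) \<in> borel_measurable M"
  unfolding gibbs_expectation_def using H
  by (intro borel_measurable_sum borel_measurable_times borel_measurable_const borel_measurable_prod
        gibbs_measurable) auto

lemma gibbs_le_1:
  assumes "\<sigma> \<in> configs N"
  shows "gibbs N h b \<sigma> \<le> 1"
proof -
  have "gibbs N h b \<sigma> \<le> (\<Sum>\<tau>\<in>configs N. gibbs N h b \<tau>)"
    using assms gibbs_pos by (intro member_le_sum) (auto simp: less_imp_le)
  then show ?thesis by (simp add: sum_gibbs)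
qed

section \<open>Averages over the disorder\<close>

context prob_space begin

lemma gibbs_expectation_integrable:
  assumes "\<And>\<tau>. \<tau> \<in> configs N \<Longrightarrow> random_variable borel (H \<tau>)"
  shows "integrable M (\<lambda>\<omega>. gibbs_expectation N (\<lambda>\<tau>. H \<tau> \<omega>) b s f)"
  unfolding gibbs_expectation_def
proof (intro Bochner_Integration.integrable_sum integrable_mult_right)
  fix \<sigma> assume \<sigma>: "\<sigma> \<in> {1..s} \<rightarrow>\<^sub>E configs N"
  then have mem: "\<sigma> k \<in> configs N" if "k \<in> {1..s}" for k using that by auto
  show "integrable M (\<lambda>\<omega>. \<Prod>k\<in>{1..s}. gibbs N (\<lambda>\<tau>. H \<tau> \<omega>) b (\<sigma> k))"
  proof (rule integrable_const_bound[where B = 1])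
    have "0 \<le> (\<Prod>k\<in>{1..s}. gibbs N h b (\<sigma> k)) \<and> (\<Prod>k\<in>{1..s}. gibbs N h b (\<sigma> k)) \<le> 1" for h
      using gibbs_pos mem gibbs_le_1 by (auto intro!: prod_nonneg prod_le_1 simp: less_imp_le)
    then show "AE \<omega> in M. norm (\<Prod>k\<in>{1..s}. gibbs N (\<lambda>\<tau>. H \<tau> \<omega>) b (\<sigma> k)) \<le> 1"
      by (simp add: abs_le_iff)
    show "random_variable borel (\<lambda>\<omega>. \<Prod>k\<in>{1..s}. gibbs N (\<lambda>\<tau>. H \<tau> \<omega>) b (\<sigma> k))"
      using assms mem by (intro borel_measurable_prod gibbs_measurable) auto
  qed
qed

text \<open>The logarithm grows at most linearly in the disorder: it lies between
  \<open>- (\<bar>b\<bar> * ?S \<omega>)\<close>, from a single configuration, and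
  \<open>ln (card (configs N)) + \<bar>b\<bar> * ?S \<omega>\<close>. First moments therefore
  suffice.\<close>

lemma ln_partition_fun_integrable:
  assumes "\<And>\<tau>. \<tau> \<in> configs N \<Longrightarrow> integrable M (H \<tau>)"
  shows "integrable M (\<lambda>\<omega>. ln (partition_fun N (\<lambda>\<tau>. H \<tau> \<omega>) b))"
proof (rule Bochner_Integration.integrable_bound)
  let ?S = "\<lambda>\<omega>. \<Sum>\<tau>\<in>configs N. \<bar>H \<tau> \<omega>\<bar>"
  show "integrable M (\<lambda>\<omega>. ln (card (configs N)) + \<bar>b\<bar> * ?S \<omega>)"
    using assms by auto
  note [measurable] = borel_measurable_integrable[OF assms]
  show "(\<lambda>\<omega>. ln (partition_fun N (\<lambda>\<tau>. H \<tau> \<omega>) b)) \<in> borel_measurable M"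
    unfolding partition_fun_def by measurable
  have card: "card (configs N) \<ge> 1"
    by (simp add: Suc_le_eq card_gt_0_iff)
  show "AE \<omega> in M. norm (ln (partition_fun N (\<lambda>\<tau>. H \<tau> \<omega>) b))
      \<le> norm (ln (card (configs N)) + \<bar>b\<bar> * ?S \<omega>)"
  proof (intro AE_I2)
    fix \<omega>
    have bH: "\<bar>b * H \<tau> \<omega>\<bar> \<le> \<bar>b\<bar> * ?S \<omega>" if "\<tau> \<in> configs N" for \<tau>
      using member_le_sum[of \<tau> "configs N" "\<lambda>\<tau>. \<bar>H \<tau> \<omega>\<bar>"] that
      by (auto simp: abs_mult intro!: mult_left_mono)
    have "partition_fun N (\<lambda>\<tau>. H \<tau> \<omega>) b \<le> (\<Sum>\<tau>\<in>configs N. exp (\<bar>b\<bar> * ?S \<omega>))"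
      unfolding partition_fun_def using bH by (intro sum_mono) (auto simp: abs_le_iff)
    also have "\<dots> = card (configs N) * exp (\<bar>b\<bar> * ?S \<omega>)" by simp
    finally have "ln (partition_fun N (\<lambda>\<tau>. H \<tau> \<omega>) b) \<le> ln (card (configs N) * exp (\<bar>b\<bar> * ?S \<omega>))"
      using partition_fun_pos by (intro ln_mono)
    also have "\<dots> = ln (card (configs N)) + \<bar>b\<bar> * ?S \<omega>"
      using card by (subst ln_mult) auto
    finally have up: "ln (partition_fun N (\<lambda>\<tau>. H \<tau> \<omega>) b) \<le> ln (card (configs N)) + \<bar>b\<bar> * ?S \<omega>" .
    obtain \<sigma> where \<sigma>: "\<sigma> \<in> configs N" using configs_nonempty by blast
    have "exp (- (\<bar>b\<bar> * ?S \<omega>)) \<le> exp (b * H \<sigma> \<omega>)"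
      using bH[OF \<sigma>] by (simp add: abs_le_iff)
    also have "\<dots> \<le> partition_fun N (\<lambda>\<tau>. H \<tau> \<omega>) b"
      unfolding partition_fun_def using \<sigma> by (intro member_le_sum) auto
    finally have "- (\<bar>b\<bar> * ?S \<omega>) \<le> ln (partition_fun N (\<lambda>\<tau>. H \<tau> \<omega>) b)"
      using partition_fun_pos by (simp add: ln_ge_iff)
    moreover have "ln (real (card (configs N))) \<ge> 0" using card by simp
    ultimately show "norm (ln (partition_fun N (\<lambda>\<tau>. H \<tau> \<omega>) b))
      \<le> norm (ln (card (configs N)) + \<bar>b\<bar> * ?S \<omega>)"
      using up by (simp add: abs_le_iff)
  qed
qed

text \<open>The replica expectation is a measurable function of the values on
  \<open>configs N\<close> alone, so its mean is an integral against the law of that vector.\<close>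

lemma gibbs_expectation_law_cong:
  assumes X: "\<And>\<tau>. \<tau> \<in> configs N \<Longrightarrow> random_variable borel (X \<tau>)"
    and Y: "\<And>\<tau>. \<tau> \<in> configs N \<Longrightarrow> random_variable borel (Y \<tau>)"
    and law: "distr M (\<Pi>\<^sub>M i\<in>configs N. borel) (\<lambda>x. \<lambda>i\<in>configs N. X i x)
      = distr M (\<Pi>\<^sub>M i\<in>configs N. borel) (\<lambda>x. \<lambda>i\<in>configs N. Y i x)"
  shows "expectation (\<lambda>\<omega>. gibbs_expectation N (\<lambda>\<tau>. X \<tau> \<omega>) b s f)
    = expectation (\<lambda>\<omega>. gibbs_expectation N (\<lambda>\<tau>. Y \<tau> \<omega>) b s f)"
proof -
  have [measurable]: "(\<lambda>x. gibbs_expectation N (\<lambda>\<tau>. x \<tau>) b s f) \<in> borel_measurable (\<Pi>\<^sub>M i\<in>configs N. borel)"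
    by (rule gibbs_expectation_measurable) measurable
  have "expectation (\<lambda>\<omega>. gibbs_expectation N (\<lambda>\<tau>. Z \<tau> \<omega>) b s f)
      = (\<integral>x. gibbs_expectation N (\<lambda>\<tau>. x \<tau>) b s f
           \<partial>distr M (\<Pi>\<^sub>M i\<in>configs N. borel) (\<lambda>x. \<lambda>i\<in>configs N. Z i x))"
    if Z [measurable]: "\<And>\<tau>. \<tau> \<in> configs N \<Longrightarrow> random_variable borel (Z \<tau>)" for Z
    by (subst integral_distr) (measurable, intro Bochner_Integration.integral_cong gibbs_expectation_cong, auto)
  then show ?thesis using X Y law by metis
qed

text \<open>Independence multiplies the characteristic functions, so the variances
  \<open>n * b\<^sup>2 * v\<close> and \<open>c\<^sup>2 * v\<close> of the two linear forms add;
  \<open>b'\<close> is fixed by matching the total.\<close>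

lemma gaussian_sum_law:
  assumes I: "finite I"
    and X: "centered_gaussian_vector M I X (\<lambda>i j. n * C i j)"
    and Y: "centered_gaussian_vector M I Y C"
    and indep: "indep_fields M I X Y"
    and b': "n * b'\<^sup>2 = n * b\<^sup>2 + c\<^sup>2"
  shows "distr M (\<Pi>\<^sub>M i\<in>I. borel) (\<lambda>\<omega>. \<lambda>i\<in>I. b * X i \<omega> + c * Y i \<omega>)
    = distr M (\<Pi>\<^sub>M i\<in>I. borel) (\<lambda>\<omega>. \<lambda>i\<in>I. b' * X i \<omega>)"
proof (rule distr_PiM_eqI_char[OF I])
  have [measurable]: "random_variable borel (X i)" "random_variable borel (Y i)" if "i \<in> I" for i
    using X Y that unfolding centered_gaussian_vector_def by auto
  then show "random_variable borel (\<lambda>\<omega>. b * X i \<omega> + c * Y i \<omega>)"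
    "random_variable borel (\<lambda>\<omega>. b' * X i \<omega>)" if "i \<in> I" for i
    using that by measurable
  fix a :: "'b \<Rightarrow> real"
  define v where "v = (\<Sum>i\<in>I. \<Sum>j\<in>I. a i * a j * C i j)"
  have char_X: "(CLINT \<omega>|M. iexp (\<Sum>i\<in>I. (u * a i) * X i \<omega>)) = exp (- (n * u\<^sup>2 * v) / 2)" for u
    unfolding centered_gaussian_vector_char[OF I X]
    by (simp add: v_def sum_distrib_left power2_eq_square mult_ac)
  have char_Y: "(CLINT \<omega>|M. iexp (\<Sum>i\<in>I. (u * a i) * Y i \<omega>)) = exp (- (u\<^sup>2 * v) / 2)" for u
    unfolding centered_gaussian_vector_char[OF I Y]
    by (simp add: v_def sum_distrib_left power2_eq_square mult_ac)
  have meas: "(\<lambda>x. iexp (\<Sum>i\<in>I. (u * a i) * x i)) \<in> borel_measurable (\<Pi>\<^sub>M i\<in>I. borel)" for u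
    by measurable
  \<comment> \<open>The linear forms read only coordinates in \<open>I\<close>, so independence of
    the restricted vectors passes to their exponentials.\<close>
  have restr: "(\<lambda>x. iexp (\<Sum>i\<in>I. (u * a i) * x i)) \<circ> (\<lambda>\<omega>. \<lambda>i\<in>I. Z i \<omega>)
      = (\<lambda>\<omega>. iexp (\<Sum>i\<in>I. (u * a i) * Z i \<omega>))" for u and Z :: "'b \<Rightarrow> 'a \<Rightarrow> real"
    by (auto simp: fun_eq_iff intro!: sum.cong)
  have "indep_var borel ((\<lambda>x. iexp (\<Sum>i\<in>I. (b * a i) * x i)) \<circ> (\<lambda>\<omega>. \<lambda>i\<in>I. X i \<omega>))
      borel ((\<lambda>x. iexp (\<Sum>i\<in>I. (c * a i) * x i)) \<circ> (\<lambda>\<omega>. \<lambda>i\<in>I. Y i \<omega>))"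
    using indep unfolding indep_fields_def by (rule indep_var_compose[OF _ meas meas])
  then have ind: "indep_var borel (\<lambda>\<omega>. iexp (\<Sum>i\<in>I. (b * a i) * X i \<omega>))
      borel (\<lambda>\<omega>. iexp (\<Sum>i\<in>I. (c * a i) * Y i \<omega>))"
    unfolding restr .
  have "(CLINT \<omega>|M. iexp (\<Sum>i\<in>I. a i * (b * X i \<omega> + c * Y i \<omega>)))
      = (CLINT \<omega>|M. iexp (\<Sum>i\<in>I. (b * a i) * X i \<omega>) * iexp (\<Sum>i\<in>I. (c * a i) * Y i \<omega>))"
    unfolding iexp_add [symmetric]
    by (intro Bochner_Integration.integral_cong refl arg_cong[where f = iexp])
       (simp add: sum.distrib[symmetric] algebra_simps)
  also have "\<dots> = (CLINT \<omega>|M. iexp (\<Sum>i\<in>I. (b * a i) * X i \<omega>)) * (CLINT \<omega>|M. iexp (\<Sum>i\<in>I. (c * a i) * Y i \<omega>))"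
    by (intro indep_var_lebesgue_integral ind integrable_const_bound[where B = 1]) (auto, measurable)
  also have "\<dots> = of_real (exp (- (n * b\<^sup>2 * v) / 2) * exp (- (c\<^sup>2 * v) / 2))"
    unfolding char_X char_Y by simp
  also have "exp (- (n * b\<^sup>2 * v) / 2) * exp (- (c\<^sup>2 * v) / 2) = exp (- ((n * b\<^sup>2 + c\<^sup>2) * v) / 2)"
    by (simp add: exp_add[symmetric] add_divide_distrib distrib_right)
  also have "of_real \<dots> = (CLINT \<omega>|M. iexp (\<Sum>i\<in>I. (b' * a i) * X i \<omega>))"
    unfolding char_X b' ..
  finally show "(CLINT \<omega>|M. iexp (\<Sum>i\<in>I. a i * (b * X i \<omega> + c * Y i \<omega>)))
      = (CLINT \<omega>|M. iexp (\<Sum>i\<in>I. a i * (b' * X i \<omega>)))"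
    by (simp add: mult_ac)
qed

text \<open>The bound for fixed disorder is averaged. Each mean log partition function is
  \<open>N\<close> times a free energy, which is where the factor \<open>N\<close> comes
  from.\<close>

lemma expectation_gibbs_expectation_increment:
  fixes s :: nat and B :: real
  assumes X: "\<And>\<tau>. \<tau> \<in> configs N \<Longrightarrow> integrable M (H \<tau>)"
    and "t > 0" "\<delta> > 0" "\<beta> \<le> \<beta>'" "\<beta>' \<le> \<beta> + \<delta>"
    and B: "\<And>\<sigma>. \<sigma> \<in> {1..s} \<rightarrow>\<^sub>E configs N \<Longrightarrow> \<bar>f \<sigma>\<bar> \<le> B" and "N > 0"
  shows "\<bar>expectation (\<lambda>\<omega>. gibbs_expectation N (\<lambda>\<tau>. H \<tau> \<omega>) \<beta>' s f)
      - expectation (\<lambda>\<omega>. gibbs_expectation N (\<lambda>\<tau>. H \<tau> \<omega>) \<beta> s f)\<bar>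
    \<le> B * s / 2 * (N * (free_energy M N H (\<beta> + 2 * \<delta>) - free_energy M N H (\<beta> + \<delta>)
        - free_energy M N H \<beta> + free_energy M N H (\<beta> - \<delta>)) / (\<delta> * t) + t * (\<beta>' - \<beta>))"
proof -
  let ?G = "\<lambda>b \<omega>. gibbs_expectation N (\<lambda>\<tau>. H \<tau> \<omega>) b s f"
  let ?L = "\<lambda>b \<omega>. ln (partition_fun N (\<lambda>\<tau>. H \<tau> \<omega>) b)"
  have G: "integrable M (?G b)" for b
    using X by (intro gibbs_expectation_integrable) auto
  have L: "integrable M (?L b)" for b
    using X by (intro ln_partition_fun_integrable)
  have fe: "expectation (?L b) = N * free_energy M N H b" for b
    using \<open>N > 0\<close> by (simp add: free_energy_def)
  have "\<bar>expectation (?G \<beta>') - expectation (?G \<beta>)\<bar> = \<bar>expectation (\<lambda>\<omega>. ?G \<beta>' \<omega> - ?G \<beta> \<omega>)\<bar>"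
    using G by simp
  also have "\<dots> \<le> expectation (\<lambda>\<omega>. \<bar>?G \<beta>' \<omega> - ?G \<beta> \<omega>\<bar>)"
    by (rule integral_abs_bound)
  also have "\<dots> \<le> expectation (\<lambda>\<omega>. B * s / 2 * ((?L (\<beta> + 2 * \<delta>) \<omega> - ?L (\<beta> + \<delta>) \<omega> - ?L \<beta> \<omega> + ?L (\<beta> - \<delta>) \<omega>) / (\<delta> * t)
      + t * (\<beta>' - \<beta>)))"
    using G L assms by (intro integral_mono gibbs_expectation_increment) auto
  also have "\<dots> = B * s / 2 * ((expectation (?L (\<beta> + 2 * \<delta>)) - expectation (?L (\<beta> + \<delta>))
      - expectation (?L \<beta>) + expectation (?L (\<beta> - \<delta>))) / (\<delta> * t) + t * (\<beta>' - \<beta>))"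
    using L by (simp add: prob_space)
  finally show ?thesis unfolding fe by (simp add: algebra_simps)
qed

end

section \<open>Uniform bounds on overlaps and on functions of replicas\<close>

lemma overlap_form_abs_le_1:
  assumes r: "overlap_form N r" and "\<sigma> \<in> configs N" "\<sigma>' \<in> configs N"
  shows "\<bar>r \<sigma> \<sigma>'\<bar> \<le> 1"
proof -
  have "0 \<le> 2 + 2 * e * r \<sigma> \<sigma>'" if e: "e * e = 1" for e :: real
  proof -
    \<comment> \<open>Positive semidefiniteness is tested on the two point masses combined with sign
      \<open>e\<close>. Adding the indicators, instead of splitting into cases, also covers
      \<open>\<sigma> = \<sigma>'\<close>.\<close>
    define c where "c \<tau> = (if \<tau> = \<sigma> then 1 else 0) + e * (if \<tau> = \<sigma>' then 1 else 0)" for \<tau>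
    have c: "(\<Sum>\<tau>\<in>configs N. c \<tau> * x \<tau>) = x \<sigma> + e * x \<sigma>'" for x
      using assms by (simp add: c_def distrib_right sum.distrib if_distrib[of "\<lambda>u. u * _"]
          mult.assoc flip: sum_distrib_left cong: if_cong)
    have "0 \<le> (\<Sum>\<tau>\<in>configs N. \<Sum>\<tau>'\<in>configs N. c \<tau> * c \<tau>' * r \<tau> \<tau>')"
      using r unfolding overlap_form_def by auto
    also have "\<dots> = r \<sigma> \<sigma> + e * r \<sigma> \<sigma>' + e * (r \<sigma>' \<sigma> + e * r \<sigma>' \<sigma>')"
      by (simp add: mult.assoc c flip: sum_distrib_left)
    also have "\<dots> = 1 + 2 * e * r \<sigma> \<sigma>' + e * e"
      using assms unfolding overlap_form_def by (simp add: algebra_simps)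
    finally show ?thesis using e by simp
  qed
  from this[of 1] this[of "-1"] show ?thesis by simp
qed

text \<open>The cube of overlap values is compact by Tychonoff and does not depend on
  \<open>N\<close>, so one \<open>B\<close> serves all system sizes and all overlap forms.\<close>

lemma at_replicas_bounded:
  assumes F: "continuous_on_replicas s F"
  obtains B where "B \<ge> 0" "\<And>N r \<sigma>. overlap_form N r \<Longrightarrow> \<sigma> \<in> {1..s} \<rightarrow>\<^sub>E configs N \<Longrightarrow> \<bar>at_replicas s r F \<sigma>\<bar> \<le> B"
proof -
  let ?T = "product_topology (\<lambda>_. top_of_set {-1..1::real}) (replica_pairs s)"
  have "compact_space ?T"
    by (simp add: compact_space_product_topology compact_space_subtopology)
  then have "compactin euclideanreal (F ` topspace ?T)"
    using F unfolding continuous_on_replicas_def compact_space_def by (intro image_compactin)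
  then have "bounded (F ` topspace ?T)" by (simp add: compact_imp_bounded)
  then obtain B where B: "\<And>x. x \<in> topspace ?T \<Longrightarrow> \<bar>F x\<bar> \<le> B"
    unfolding bounded_iff by auto
  show ?thesis
  proof (rule that[of "max B 0"])
    fix N r \<sigma> assume r: "overlap_form N r" and \<sigma>: "\<sigma> \<in> {1..s} \<rightarrow>\<^sub>E configs N"
    have "- 1 \<le> r (\<sigma> k) (\<sigma> l) \<and> r (\<sigma> k) (\<sigma> l) \<le> 1" if "(k, l) \<in> replica_pairs s" for k l
    proof -
      have "\<sigma> k \<in> configs N" "\<sigma> l \<in> configs N"
        using that \<sigma> by (auto simp: replica_pairs_def)
      from overlap_form_abs_le_1[OF r this] show ?thesis by linarith
    qed
    then have "restrict (\<lambda>(k, l). r (\<sigma> k) (\<sigma> l)) (replica_pairs s) \<in> topspace ?T"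
      by (auto simp: restrict_PiE_iff)
    then show "\<bar>at_replicas s r F \<sigma>\<bar> \<le> max B 0"
      unfolding at_replicas_def using B by (simp add: le_max_iff_disj)
  qed simp
qed

section \<open>Stochastic stability\<close>

theorem proposition1p10:
  fixes M :: "nat \<Rightarrow> 'a measure"
    and r :: "nat \<Rightarrow> config \<Rightarrow> config \<Rightarrow> real"
    and H l :: "nat \<Rightarrow> config \<Rightarrow> 'a \<Rightarrow> real"
    and \<beta> lam :: real and s :: nat
    and F :: "(nat \<times> nat \<Rightarrow> real) \<Rightarrow> real"
  assumes "\<And>N. N \<ge> 1 \<Longrightarrow> gaussian_spin_glass (M N) N (r N) (H N)"
    and "\<And>N. N \<ge> 1 \<Longrightarrow> centered_gaussian_vector (M N) (configs N) (l N) (r N)"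
    and "\<And>N. N \<ge> 1 \<Longrightarrow> indep_fields (M N) (configs N) (H N) (l N)"
    and "\<beta> > 0"
    and "\<forall>\<^sub>F b in nhds \<beta>. convergent (\<lambda>N. free_energy (M N) N (H N) b)"
    and "(\<lambda>b. lim (\<lambda>N. free_energy (M N) N (H N) b)) differentiable (at \<beta>)"
    and "lam > 0"
    and "continuous_on_replicas s F"
  shows "(\<lambda>N. \<bar>(\<integral>\<omega>. gibbs_expectation N (\<lambda>\<sigma>. H N \<sigma> \<omega>) \<beta> s
                    (\<lambda>\<sigma>. at_replicas s (r N) F \<sigma> * (\<Prod>k\<in>{1..s}. exp (lam * l N (\<sigma> k) \<omega>)))
                / gibbs_expectation N (\<lambda>\<sigma>. H N \<sigma> \<omega>) \<beta> s
                    (\<lambda>\<sigma>. \<Prod>k\<in>{1..s}. exp (lam * l N (\<sigma> k) \<omega>)) \<partial>M N)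
            - (\<integral>\<omega>. gibbs_expectation N (\<lambda>\<sigma>. H N \<sigma> \<omega>) \<beta> s (at_replicas s (r N) F) \<partial>M N)\<bar>)
         \<longlonglongrightarrow> 0"
    (is "(\<lambda>N. \<bar>?A N - ?G N\<bar>) \<longlonglongrightarrow> 0")
proof -
  obtain B where B: "B \<ge> 0"
      "\<And>N r \<sigma>. overlap_form N r \<Longrightarrow> \<sigma> \<in> {1..s} \<rightarrow>\<^sub>E configs N \<Longrightarrow> \<bar>at_replicas s r F \<sigma>\<bar> \<le> B"
    using at_replicas_bounded[OF assms(8)] by blast
  define fe where "fe N = free_energy (M N) N (H N)" for N
  define \<phi> where "\<phi> b = lim (\<lambda>N. fe N b)" for b
  \<comment> \<open>\<open>D N \<delta>\<close> is the difference of the increments of the free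
    energy over [\<beta> + \<delta>, \<beta> + 2 \<delta>] and [\<beta> - \<delta>, \<beta>];
    \<open>E\<close> is its limit in \<open>N\<close>.\<close>
  define D where "D N \<delta> = fe N (\<beta> + 2 * \<delta>) - fe N (\<beta> + \<delta>) - fe N \<beta> + fe N (\<beta> - \<delta>)" for N \<delta>
  define E where "E \<delta> = \<phi> (\<beta> + 2 * \<delta>) - \<phi> (\<beta> + \<delta>) - \<phi> \<beta> + \<phi> (\<beta> - \<delta>)" for \<delta>
  define K c where "K = B * s / 2" and "c = lam\<^sup>2 / (2 * \<beta>)"
  have K: "K \<ge> 0" and c: "c > 0" using B assms by (auto simp: K_def c_def)
  \<comment> \<open>Here \<delta> and \<eta> do not depend on \<open>N\<close>. The condition
    \<open>c \<le> N * \<delta>\<close> keeps the shifted inverse temperature within \<delta> of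
    \<beta>.\<close>
  have bound: "\<bar>?A N - ?G N\<bar> \<le> K * (D N \<delta> / (\<delta> * \<eta>) + \<eta> * c)"
    if N: "N \<ge> 1" "c \<le> N * \<delta>" and \<delta>: "\<delta> > 0" and \<eta>: "\<eta> > 0" for N \<delta> \<eta>
  proof -
    have sg: "prob_space (M N)" "overlap_form N (r N)"
      "centered_gaussian_vector (M N) (configs N) (H N) (\<lambda>\<sigma> \<sigma>'. real N * r N \<sigma> \<sigma>')"
      using assms(1)[OF N(1)] unfolding gaussian_spin_glass_def by auto
    interpret prob_space "M N" by fact
    have [measurable]: "random_variable borel (H N \<tau>)" "random_variable borel (l N \<tau>)"
      if "\<tau> \<in> configs N" for \<tau>
      using sg(3) assms(2)[OF N(1)] that unfolding centered_gaussian_vector_def by auto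
    define \<beta>' where "\<beta>' = sqrt (\<beta>\<^sup>2 + lam\<^sup>2 / N)"
    have \<beta>'_sq: "\<beta>'\<^sup>2 = \<beta>\<^sup>2 + lam\<^sup>2 / N" by (simp add: \<beta>'_def)
    have le: "\<beta> \<le> \<beta>'" unfolding \<beta>'_def by (rule real_le_rsqrt) simp
    \<comment> \<open>Factoring the difference of squares gives
      \<open>N * (\<beta>' - \<beta>) \<le> c\<close>, which explains the value of
      \<open>c\<close>.\<close>
    have "2 * \<beta> * (\<beta>' - \<beta>) \<le> (\<beta>' + \<beta>) * (\<beta>' - \<beta>)"
      using le by (intro mult_right_mono) auto
    also have "\<dots> = lam\<^sup>2 / N" using \<beta>'_sq by (simp add: algebra_simps power2_eq_square)
    finally have diff: "N * (\<beta>' - \<beta>) \<le> c"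
      using N \<open>\<beta> > 0\<close> by (simp add: c_def field_simps)
    then have "N * (\<beta>' - \<beta>) \<le> N * \<delta>" using N by linarith
    then have le': "\<beta>' \<le> \<beta> + \<delta>" using N by simp
    \<comment> \<open>Three moves: write the tilted quotient as one replica expectation at inverse
      temperature 1, exchange the Gaussian field for one of equal law, and rescale back to
      \<open>H N\<close> at \<beta>'.\<close>
    have "?A N = expectation (\<lambda>\<omega>. gibbs_expectation N (\<lambda>\<tau>. \<beta> * H N \<tau> \<omega> + lam * l N \<tau> \<omega>) 1 s (at_replicas s (r N) F))"
      by (intro Bochner_Integration.integral_cong refl
          gibbs_expectation_tilt[where h = "\<lambda>\<tau>. H N \<tau> \<omega>" and u = "\<lambda>\<tau>. l N \<tau> \<omega>" for \<omega>])
    also have "\<dots> = expectation (\<lambda>\<omega>. gibbs_expectation N (\<lambda>\<tau>. \<beta>' * H N \<tau> \<omega>) 1 s (at_replicas s (r N) F))"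
    proof (rule gibbs_expectation_law_cong)
      show "distr (M N) (\<Pi>\<^sub>M i\<in>configs N. borel) (\<lambda>\<omega>. \<lambda>i\<in>configs N. \<beta> * H N i \<omega> + lam * l N i \<omega>)
        = distr (M N) (\<Pi>\<^sub>M i\<in>configs N. borel) (\<lambda>\<omega>. \<lambda>i\<in>configs N. \<beta>' * H N i \<omega>)"
        using N assms(2,3)[OF N(1)] sg(3)
        by (intro gaussian_sum_law[where n = "real N" and C = "r N"]) (auto simp: \<beta>'_sq field_simps)
    qed measurable
    also have "\<dots> = expectation (\<lambda>\<omega>. gibbs_expectation N (\<lambda>\<tau>. H N \<tau> \<omega>) \<beta>' s (at_replicas s (r N) F))"
      unfolding gibbs_expectation_def gibbs_rescale ..
    \<comment> \<open>The scale is \<open>t = \<eta> * N\<close>, so the factors \<open>N\<close>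
      cancel in the first term and the second is at most \<eta> \<open>c\<close>.\<close>
    finally have "\<bar>?A N - ?G N\<bar> \<le> K * (N * D N \<delta> / (\<delta> * (\<eta> * N)) + \<eta> * N * (\<beta>' - \<beta>))"
      unfolding K_def D_def fe_def
      using expectation_gibbs_expectation_increment[where H = "H N" and t = "\<eta> * N" and \<delta> = \<delta> and \<beta> = \<beta> and \<beta>' = \<beta>'
          and s = s and f = "at_replicas s (r N) F" and B = B and N = N]
        centered_gaussian_vector_integrable(1)[OF finite_configs sg(3)] le le' N \<delta> \<eta> B(2)[OF sg(2)]
      by simp
    also have "\<dots> \<le> K * (D N \<delta> / (\<delta> * \<eta>) + \<eta> * c)"
      using K N \<delta> \<eta> diff by (intro mult_left_mono add_mono) (auto simp: mult.assoc)
    finally show ?thesis .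
  qed
  obtain d where "(\<phi> has_real_derivative d) (at \<beta>)"
    using assms(6) unfolding \<phi>_def [abs_def] fe_def real_differentiable_def by blast
  then have \<phi>: "((\<lambda>x. \<phi> (\<beta> + a * x)) has_real_derivative d * a) (at 0)" for a
  proof -
    have "((\<lambda>x. \<beta> + a * x) has_real_derivative a) (at 0)"
      by (auto intro!: derivative_eq_intros)
    from DERIV_chain2[OF _ this, of \<phi> d] show ?thesis
      using \<open>(\<phi> has_real_derivative d) (at \<beta>)\<close> by simp
  qed
  \<comment> \<open>The slopes cancel, 2d - d - d = 0, so \<open>E\<close> is of smaller order than
    \<delta>; this is where differentiability at \<beta> enters.\<close>
  have "(E has_real_derivative d * 2 - d * 1 - 0 + d * (-1)) (at 0)"
    unfolding E_def [abs_def] using \<phi>[of 2] \<phi>[of 1] \<phi>[of "-1"]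
    by (intro DERIV_add DERIV_diff DERIV_const) simp_all
  moreover have "E 0 = 0" by (simp add: E_def)
  ultimately have "(\<lambda>\<delta>. E \<delta> / \<delta>) \<midarrow>0\<rightarrow> 0"
    by (simp add: has_field_derivative_iff)
  then have E: "((\<lambda>\<delta>. E \<delta> / \<delta>) \<longlongrightarrow> 0) (at_right 0)"
    by (rule filterlim_mono) (auto simp: at_le)
  \<comment> \<open>Near \<beta> the free energies converge, so there \<open>lim\<close> is a
    genuine limit; \<open>a\<close> will be 2, 1, 0 and -1.\<close>
  have conv: "\<forall>\<^sub>F \<delta> in at_right 0. (\<lambda>N. fe N (\<beta> + a * \<delta>)) \<longlonglongrightarrow> \<phi> (\<beta> + a * \<delta>)" for a
  proof -
    have "((\<lambda>\<delta>. \<beta> + a * \<delta>) \<longlongrightarrow> \<beta>) (at_right 0)"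
      by (auto intro!: tendsto_eq_intros)
    then have "\<forall>\<^sub>F \<delta> in at_right 0. convergent (\<lambda>N. fe N (\<beta> + a * \<delta>))"
      unfolding fe_def by (rule eventually_compose_filterlim[OF assms(5)])
    then show ?thesis by eventually_elim (simp add: \<phi>_def convergent_LIMSEQ_iff)
  qed
  show ?thesis
  proof (rule tendstoI)
    fix e :: real assume e: "e > 0"
    \<comment> \<open>This makes the error \<eta> \<open>K * c\<close> smaller than
      \<open>e\<close>; the added 1 avoids division by 0 when \<open>K = 0\<close>.\<close>
    define \<eta> where "\<eta> = e / (K * c + 1)"
    have Kc: "K * c + 1 > 0" using K c by (simp add: add_nonneg_pos)
    then have \<eta>: "\<eta> > 0" "K * (\<eta> * c) < e"
      using e by (auto simp: \<eta>_def field_simps)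
    have "((\<lambda>\<delta>. K * (E \<delta> / \<delta> / \<eta> + \<eta> * c)) \<longlongrightarrow> K * (0 / \<eta> + \<eta> * c)) (at_right 0)"
      using \<eta> by (intro tendsto_intros E) auto
    then have "\<forall>\<^sub>F \<delta> in at_right 0. K * (E \<delta> / \<delta> / \<eta> + \<eta> * c) < e"
      by (rule order_tendstoD) (use \<eta> in simp)
    then have "\<forall>\<^sub>F \<delta> in at_right 0. \<delta> > 0 \<and> K * (E \<delta> / \<delta> / \<eta> + \<eta> * c) < e \<and> (\<lambda>N. D N \<delta>) \<longlonglongrightarrow> E \<delta>"
      using conv[of 2] conv[of 1] conv[of 0] conv[of "-1"] eventually_at_right_less[of "0::real"]
    proof eventually_elim
      case (elim \<delta>)
      then show ?case unfolding D_def E_def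
        by (auto intro!: tendsto_intros)
    qed
    \<comment> \<open>Order of choice: first \<eta>, then \<delta> depending on \<eta>, and only
      then \<open>N\<close> large.\<close>
    then obtain \<delta> where \<delta>: "\<delta> > 0" "K * (E \<delta> / \<delta> / \<eta> + \<eta> * c) < e" "(\<lambda>N. D N \<delta>) \<longlonglongrightarrow> E \<delta>"
      using eventually_happens'[OF trivial_limit_at_right_real] by blast
    have "(\<lambda>N. K * (D N \<delta> / (\<delta> * \<eta>) + \<eta> * c)) \<longlonglongrightarrow> K * (E \<delta> / (\<delta> * \<eta>) + \<eta> * c)"
      using \<delta> \<eta> by (intro tendsto_intros) auto
    then have "\<forall>\<^sub>F N in sequentially. K * (D N \<delta> / (\<delta> * \<eta>) + \<eta> * c) < e"
      by (rule order_tendstoD) (use \<delta> in simp)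
    \<comment> \<open>For such \<open>N\<close> the shift of the inverse temperature fits below
      \<delta>.\<close>
    moreover have "\<forall>\<^sub>F N in sequentially. c / \<delta> \<le> real N"
      using filterlim_real_sequentially unfolding filterlim_at_top by blast
    ultimately show "\<forall>\<^sub>F N in sequentially. dist \<bar>?A N - ?G N\<bar> 0 < e"
      using eventually_ge_at_top[of 1]
    proof eventually_elim
      case (elim N)
      then have "c \<le> N * \<delta>" using \<delta> by (simp add: field_simps)
      from bound[OF \<open>1 \<le> N\<close> this \<delta>(1) \<eta>(1)] show ?case using elim by simp
    qed
  qed
qed

end
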